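(* Let $\Gamma$ be a clique (complete graph) of order $k\ge 2$. Let $A\subseteq\mathbb{R}^d$ be open with $\mathrm{Leb}(\partial A)=0$, and suppose $\lim_{n\to\infty} r_n=0$. Then $$E(G'_{n,A}(\Gamma))=p_n^{\binom{k}{2}}E(G_{n,A}(\Gamma)).$$ Moreover, $$\lim_{n\to\infty}p_n^{-\binom{k}{2}}n^{-k}r_n^{-d(k-1)}E(G'_{n,A}(\Gamma))=\mu_{\Gamma,A}.$$
   Context: Let $f:\mathbb{R}^d\to[0,\infty)$ be a bounded measurable probability density, and let $X_1,X_2,\dots$ be i.i.d. random points in $\mathbb{R}^d$ with density $f$. Put $\mathcal{X}_n=\{X_1,\dots,X_n\}$. Let $r_n>0$ and $p_n\in(0,1]$ be sequences. For a finite set $\mathcal{Y}\subset\mathbb{R}^d$ and $r>0$, $G(\mathcal{Y};r)$ is the graph with vertex set $\mathcal{Y}$ in which two distinct points are joined by an edge iff their Euclidean distance is at most $r$. The percolated random geometric graph $G(\mathcal{X}_n;p_n,r_n)$ is obtained from $G(\mathcal{X}_n;r_n)$ by keeping each edge with probability $p_n$ and deleting it otherwise, independently for all edges (and independently of the points). $G_{n,A}(\Gamma)$ (respectively $G'_{n,A}(\Gamma)$) is the number of induced subgraphs of $G(\mathcal{X}_n;r_n)$ (respectively of $G(\mathcal{X}_n;p_n,r_n)$) that are isomorphic to $\Gamma$ and whose vertex set has its left-most point (the point with smallest first coordinate) in $A$. For a finite set $\mathcal{Y}\subset\mathbb{R}^d$, $h_\Gamma(\mathcal{Y})=1$ if $G(\mathcal{Y};1)\cong\Gamma$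 and $h_\Gamma(\mathcal{Y})=0$ otherwise (in particular $0$ unless $\mathcal{Y}$ has $k$ elements). Set $$\mu_{\Gamma,A}=\frac{1}{k!}\int_A f(x)^k\,dx\int_{(\mathbb{R}^d)^{k-1}}h_\Gamma(\{0,x_1,\dots,x_{k-1}\})\,d(x_1,\dots,x_{k-1}).$$ *)

theory Defs
  imports "HOL-Probability.Probability" "Graph_Theory.Graph_Theory"
begin

text \<open>
  Undirected simple graphs are represented, as in the Graph\_Theory entry, by symmetric loop-free
  digraphs: an edge between \<open>x\<close> and \<open>y\<close> is the pair of arcs \<open>(x, y)\<close>, \<open>(y, x)\<close>.
\<close>

definition rgg :: "'a::metric_space set \<Rightarrow> real \<Rightarrow> 'a pair_pre_digraph" where
  "rgg Y r = \<lparr> pverts = Y, parcs = {(x, y). x \<in> Y \<and> y \<in> Y \<and> x \<noteq> y \<and> dist x y \<le> r} \<rparr>"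

definition index_pairs :: "nat \<Rightarrow> nat set set" where
  "index_pairs n = {e. e \<subseteq> {1..n} \<and> card e = 2}"

text \<open>
  The coin deciding whether the edge between the \<open>i\<close>-th and the \<open>j\<close>-th point is kept is
  \<open>keep {i, j}\<close>. There is a coin for every pair of indices; those of non-adjacent pairs are
  never looked at. Since the points have a density, they are almost surely distinct, so that
  almost surely exactly one coin belongs to each edge.
\<close>

definition percolated_rgg ::
    "nat \<Rightarrow> (nat \<Rightarrow> 'a::metric_space) \<Rightarrow> (nat set \<Rightarrow> bool) \<Rightarrow> real \<Rightarrow> 'a pair_pre_digraph" where
  "percolated_rgg n X keep r =
     (let G = rgg (X ` {1..n}) r in
      \<lparr> pverts = pverts G,
        parcs = {(x, y). (x, y) \<in> parcs G \<and> (\<exists>e\<in>index_pairs n. keep e \<and> X ` e = {x, y})} \<rparr>)"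

text \<open>
  The first coordinate is the one with the least index. If several points of \<open>S\<close> share the
  smallest first coordinate (a null event for points with a density), all of them count as
  left-most.
\<close>

definition is_leftmost :: "(real ^ 'd::{finite,linorder}) set \<Rightarrow> real ^ 'd::{finite,linorder} \<Rightarrow> bool" where
  "is_leftmost S x \<longleftrightarrow> is_arg_min (\<lambda>y. y $ Min UNIV) (\<lambda>y. y \<in> S) x"

definition induced_count ::
    "('v, 'e) pre_digraph \<Rightarrow> (real ^ 'd::{finite,linorder}) set
       \<Rightarrow> (real ^ 'd::{finite,linorder}) pair_pre_digraph \<Rightarrow> nat" where
  "induced_count \<Gamma> A G =
     card {H. induced_subgraph H (with_proj G) \<and> digraph_iso H \<Gamma> \<and>
              (\<exists>x\<in>A. is_leftmost (verts H) x)}"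

definition rgg_count ::
    "('v, 'e) pre_digraph \<Rightarrow> (real ^ 'd::{finite,linorder}) set
       \<Rightarrow> (nat \<Rightarrow> 'w \<Rightarrow> real ^ 'd::{finite,linorder}) \<Rightarrow> (nat \<Rightarrow> real) \<Rightarrow> nat \<Rightarrow> 'w \<Rightarrow> nat" where
  "rgg_count \<Gamma> A X r n \<omega> = induced_count \<Gamma> A (rgg ((\<lambda>i. X i \<omega>) ` {1..n}) (r n))"

definition percolated_rgg_count ::
    "('v, 'e) pre_digraph \<Rightarrow> (real ^ 'd::{finite,linorder}) set
       \<Rightarrow> (nat \<Rightarrow> 'w \<Rightarrow> real ^ 'd::{finite,linorder}) \<Rightarrow> (nat \<Rightarrow> nat set \<Rightarrow> 'w \<Rightarrow> bool)
       \<Rightarrow> (nat \<Rightarrow> real) \<Rightarrow> nat \<Rightarrow> 'w \<Rightarrow> nat" where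
  "percolated_rgg_count \<Gamma> A X keep r n \<omega> =
     induced_count \<Gamma> A (percolated_rgg n (\<lambda>i. X i \<omega>) (\<lambda>e. keep n e \<omega>) (r n))"

definition h_fun :: "('v, 'e) pre_digraph \<Rightarrow> 'a::metric_space set \<Rightarrow> real" where
  "h_fun \<Gamma> Y = (if digraph_iso (with_proj (rgg Y 1)) \<Gamma> then 1 else 0)"

text \<open>
  A point \<open>(x\<^sub>1, \<dots>, x\<^sub>k\<^sub>-\<^sub>1)\<close> of the \<open>(k-1)\<close>-fold power of the space is a function on the
  index set \<open>{1..<k}\<close>.
\<close>

definition mu_limit ::
    "(real ^ 'd::finite \<Rightarrow> real) \<Rightarrow> ('v, 'e) pre_digraph \<Rightarrow> (real ^ 'd::finite) set \<Rightarrow> real" where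
  "mu_limit f \<Gamma> A =
     (let k = card (verts \<Gamma>) in
      1 / fact k * (LINT x:A|lborel. f x ^ k) *
      (LINT x|(\<Pi>\<^sub>M i\<in>{1..<k}. lborel). h_fun \<Gamma> (insert (0 :: real ^ 'd::finite) (x ` {1..<k}))))"

text \<open>The events determined by a random variable \<open>Y\<close> with values in the measurable space \<open>N\<close>.\<close>

definition events_of :: "'w measure \<Rightarrow> 'b measure \<Rightarrow> ('w \<Rightarrow> 'b) \<Rightarrow> 'w set set" where
  "events_of M N Y = {Y -` S \<inter> space M | S. S \<in> sets N}"

text \<open>
  Joint independence of all points and all coins is expressed on the level of the generated
  events, because the independence of random variables in the library requires a common
  value type.
\<close>

definition percolation_model ::
    "'w measure \<Rightarrow> (real ^ 'd::finite \<Rightarrow> real) \<Rightarrow> (nat \<Rightarrow> 'w \<Rightarrow> real ^ 'd::finite)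
       \<Rightarrow> (nat \<Rightarrow> real) \<Rightarrow> (nat \<Rightarrow> nat set \<Rightarrow> 'w \<Rightarrow> bool) \<Rightarrow> bool" where
  "percolation_model M f X p keep \<longleftrightarrow>
     prob_space M \<and>
     (\<forall>i\<ge>1. distributed M lborel (X i) (\<lambda>x. ennreal (f x))) \<and>
     prob_space.indep_vars M (\<lambda>_. borel) X {1..} \<and>
     (\<forall>n\<ge>1. \<forall>e\<in>index_pairs n.
        keep n e \<in> measurable M (count_space UNIV) \<and>
        measure M {\<omega> \<in> space M. keep n e \<omega>} = p n) \<and>
     (\<forall>n\<ge>1. prob_space.indep_sets M
        (case_sum (\<lambda>i. events_of M borel (X i)) (\<lambda>e. events_of M (count_space UNIV) (keep n e)))
        (Inl ` {1..} \<union> Inr ` index_pairs n))"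

end

theory Submission
  imports Defs
begin

text \<open>
  A copy of the complete graph on \<open>k\<close> vertices is nothing but a set \<open>S\<close> of \<open>k\<close> points that are
  pairwise adjacent: an induced subgraph is determined by its vertex set, and completeness fixes all
  of its arcs. The points are almost surely distinct, so both counts are almost surely sums, over the
  \<open>k\<close>-subsets \<open>I\<close> of \<open>{1..n}\<close>, of indicators. For the geometric graph the event is that the points
  with index in \<open>I\<close> are pairwise within distance \<open>r n\<close> and have their left-most point in \<open>A\<close>; for the
  percolated graph all \<open>k choose 2\<close> coins of the pairs inside \<open>I\<close> must come up in addition. Since the
  coins are independent of each other and of the points, every term of the second sum has \<open>p n\<close> to the
  power \<open>k choose 2\<close> times the probability of the corresponding term of the first
  (\<open>prob_kept_independent\<close>). This is the identity between the expectations.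

  The points are independent and identically distributed, so the expected number of cliques is
  \<open>n choose k\<close> times one single probability, called \<open>rooted_prob\<close> below. In the \<open>k\<close>-fold integral
  for that probability substitute \<open>x\<^sub>i = x\<^sub>0 + r z\<^sub>i\<close> for \<open>i > 0\<close> (\<open>rooted_prob_rescaled\<close>). Closeness at scale \<open>r\<close> becomes
  closeness at scale 1 of \<open>0, z\<^sub>1, \<dots>, z\<^sub>k\<^sub>-\<^sub>1\<close>, which no longer involves \<open>x\<^sub>0\<close> or \<open>r\<close>, the Jacobian is
  \<open>r\<close> to the power \<open>d (k - 1)\<close>, and for fixed \<open>z\<close> there remains an integral over \<open>x\<^sub>0\<close> of a product of
  translates of the density by vectors that tend to 0. Translation is continuous in \<open>L\<^sup>1\<close>
  (\<open>translation_continuous_L1\<close>); as the density is bounded, and as almost no point lies on the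
  frontier of \<open>A\<close>, that integral tends to the integral of the \<open>k\<close>-th power of the density over \<open>A\<close>
  (\<open>tendsto_prod_translates\<close>). The admissible \<open>z\<close> lie in a product of unit balls, so
  dominated convergence gives the limit of \<open>rooted_prob\<close>, and \<open>n choose k\<close> is asymptotic to \<open>n ^ k / fact k\<close>.

  One point needs care that is invisible on paper: the Bochner integral of a non-measurable function is
  0 by convention, and the probability space is not assumed to be complete. Hence the counts have to be
  measurable on the whole space, including the null event that two points coincide. For this reason the
  sums over index sets are first established without exception, with the extra condition that \<open>I\<close>
  consists of \<open>first_indices\<close>, and simplified almost surely only afterwards.
\<close>

section \<open>Complete subgraphs\<close>

text \<open>
  A digraph isomorphism in this sense maps vertices and arcs separately and lets the image choose its
  own \<open>head\<close> and \<open>tail\<close>. From left to right, the arc between two given vertices is pulled back from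
  \<open>\<Gamma>\<close>, using that vertices are mapped injectively. From right to left, any bijection of the vertices
  works, because in \<open>\<Gamma>\<close> there is exactly one arc from each vertex to each other one; the assumption
  \<open>k \<ge> 1\<close> excludes infinite vertex sets, whose cardinality is 0.
\<close>

lemma digraph_iso_complete_iff:
  assumes complete: "complete_digraph k \<Gamma>" and "k \<ge> 1"
    and off_diagonal: "parcs H \<subseteq> {(x, y). x \<in> pverts H \<and> y \<in> pverts H \<and> x \<noteq> y}"
  shows "digraph_iso (with_proj H) \<Gamma> \<longleftrightarrow>
           card (pverts H) = k \<and> parcs H = {(x, y). x \<in> pverts H \<and> y \<in> pverts H \<and> x \<noteq> y}"
    (is "_ \<longleftrightarrow> _ \<and> _ = ?D")
proof
  interpret \<Gamma>: graph \<Gamma>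
    using complete by (simp add: complete_digraph_def)
  have card_\<Gamma>: "card (verts \<Gamma>) = k"
    and ends_\<Gamma>: "arc_to_ends \<Gamma> ` arcs \<Gamma> = {(u, v). u \<in> verts \<Gamma> \<and> v \<in> verts \<Gamma> \<and> u \<noteq> v}"
    using complete by (auto simp: complete_digraph_def arcs_ends_def)
  {
    assume "digraph_iso (with_proj H) \<Gamma>"
    then obtain h where "pre_digraph.digraph_isomorphism (with_proj H) h"
      and \<Gamma>_eq: "\<Gamma> = app_iso h (with_proj H)"
      by (auto simp: digraph_iso_def)
    then have inj: "inj_on (iso_verts h) (pverts H)"
      and ends: "\<And>a. a \<in> parcs H \<Longrightarrow> iso_tail h (iso_arcs h a) = iso_verts h (fst a) \<and>
                   iso_head h (iso_arcs h a) = iso_verts h (snd a)"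
      by (auto simp: pre_digraph.digraph_isomorphism_def)
    have "card (pverts H) = k"
      using card_\<Gamma> inj by (simp add: \<Gamma>_eq card_image)
    moreover have "(x, y) \<in> parcs H" if "x \<in> pverts H" "y \<in> pverts H" "x \<noteq> y" for x y
    proof -
      have "(iso_verts h x, iso_verts h y) \<in> arc_to_ends \<Gamma> ` arcs \<Gamma>"
        using that inj unfolding ends_\<Gamma> by (auto simp: \<Gamma>_eq inj_on_eq_iff)
      then obtain a where a: "a \<in> parcs H" "iso_verts h (fst a) = iso_verts h x"
          "iso_verts h (snd a) = iso_verts h y"
        using ends by (auto simp: \<Gamma>_eq arc_to_ends_def)
      moreover have "fst a \<in> pverts H" "snd a \<in> pverts H"
        using a off_diagonal by auto
      ultimately have "a = (x, y)"
        using that inj by (auto simp: inj_on_eq_iff prod_eq_iff)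
      with a show ?thesis by simp
    qed
    ultimately show "card (pverts H) = k \<and> parcs H = ?D"
      using off_diagonal by auto
  next
    assume H: "card (pverts H) = k \<and> parcs H = ?D"
    then have "finite (pverts H)"
      using \<open>k \<ge> 1\<close> by (intro card_ge_0_finite) auto
    then obtain g where g: "bij_betw g (pverts H) (verts \<Gamma>)"
      using H card_\<Gamma> \<Gamma>.finite_verts by (metis finite_same_card_bij)
    \<comment> \<open>The unique arc of \<open>\<Gamma>\<close> with the given ends, which serves as the image of the arc between their preimages.\<close>
    define arc_of where "arc_of = the_inv_into (arcs \<Gamma>) (arc_to_ends \<Gamma>)"
    have inj_ends: "inj_on (arc_to_ends \<Gamma>) (arcs \<Gamma>)"
      by (rule \<Gamma>.inj_on_arc_to_ends)
    have arc_of: "arc_to_ends \<Gamma> (arc_of (u, v)) = (u, v) \<and> arc_of (u, v) \<in> arcs \<Gamma>"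
      if "u \<in> verts \<Gamma>" "v \<in> verts \<Gamma>" "u \<noteq> v" for u v
    proof -
      have "(u, v) \<in> arc_to_ends \<Gamma> ` arcs \<Gamma>"
        using that unfolding ends_\<Gamma> by auto
      then show ?thesis
        unfolding arc_of_def
        using f_the_inv_into_f[OF inj_ends] the_inv_into_into[OF inj_ends] by blast
    qed
    define h where "h = \<lparr>iso_verts = g, iso_arcs = (\<lambda>(x, y). arc_of (g x, g y)),
      iso_head = head \<Gamma>, iso_tail = tail \<Gamma>\<rparr>"
    have g_in: "g x \<in> verts \<Gamma>" if "x \<in> pverts H" for x
      using g that by (auto simp: bij_betw_def)
    have g_eq: "g x = g y \<longleftrightarrow> x = y" if "x \<in> pverts H" "y \<in> pverts H" for x y
      using g that by (auto simp: bij_betw_def inj_on_eq_iff)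
    have arc: "tail \<Gamma> (arc_of (g x, g y)) = g x" "head \<Gamma> (arc_of (g x, g y)) = g y"
        "arc_of (g x, g y) \<in> arcs \<Gamma>"
      if "x \<in> pverts H" "y \<in> pverts H" "x \<noteq> y" for x y
      using arc_of[of "g x" "g y"] that g_in g_eq by (auto simp: arc_to_ends_def)
    have "inj_on (\<lambda>(x, y). arc_of (g x, g y)) (parcs H)"
    proof (rule inj_onI, clarify)
      fix x y x' y'
      assume "(x, y) \<in> parcs H" "(x', y') \<in> parcs H"
        and eq: "arc_of (g x, g y) = arc_of (g x', g y')"
      then have *: "x \<in> pverts H" "y \<in> pverts H" "x \<noteq> y" "x' \<in> pverts H" "y' \<in> pverts H" "x' \<noteq> y'"
        using H by auto
      then have "g x = g x'" "g y = g y'"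
        using arc[of x y] arc[of x' y'] eq by auto
      then show "x = x' \<and> y = y'"
        using * g_eq by auto
    qed
    moreover have "wf_digraph (with_proj H)"
      using off_diagonal by unfold_locales auto
    ultimately have "pre_digraph.digraph_isomorphism (with_proj H) h"
      using g arc H by (auto simp: pre_digraph.digraph_isomorphism_def h_def bij_betw_def)
    moreover have "\<Gamma> = app_iso h (with_proj H)"
    proof (rule pre_digraph.equality)
      show "verts \<Gamma> = verts (app_iso h (with_proj H))"
        using g by (simp add: h_def bij_betw_def)
      show "arcs \<Gamma> = arcs (app_iso h (with_proj H))"
      proof (intro equalityI subsetI)
        fix a assume a: "a \<in> arcs \<Gamma>"
        then have "tail \<Gamma> a \<in> g ` pverts H" "head \<Gamma> a \<in> g ` pverts H"
          using g by (auto simp: bij_betw_def)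
        then obtain x y where xy: "x \<in> pverts H" "y \<in> pverts H" "tail \<Gamma> a = g x" "head \<Gamma> a = g y"
          by auto
        moreover have "x \<noteq> y"
          using xy a \<Gamma>.no_loops by metis
        moreover have "arc_of (g x, g y) = a"
          using xy arc[OF xy(1,2) \<open>x \<noteq> y\<close>] a \<Gamma>.no_multi_arcs by (auto simp: arc_to_ends_def)
        ultimately have "a = iso_arcs h (x, y)" "(x, y) \<in> parcs H"
          using H by (auto simp: h_def)
        then show "a \<in> arcs (app_iso h (with_proj H))" by simp
      next
        fix a assume "a \<in> arcs (app_iso h (with_proj H))"
        then show "a \<in> arcs \<Gamma>" using H arc(3) by (auto simp: h_def)
      qed
    qed (auto simp: h_def)
    ultimately show "digraph_iso (with_proj H) \<Gamma>"
      by (auto simp: digraph_iso_def)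
  }
qed

text \<open>
  The map \<open>sub\<close> below is a bijection between vertex sets and induced subgraphs.
\<close>

lemma induced_count_complete:
  assumes complete: "complete_digraph k \<Gamma>" and "k \<ge> 1"
    and off_diagonal: "parcs G \<subseteq> {(x, y). x \<in> pverts G \<and> y \<in> pverts G \<and> x \<noteq> y}"
  shows "induced_count \<Gamma> A G =
    card {S. S \<subseteq> pverts G \<and> card S = k \<and> (\<forall>x\<in>S. \<forall>y\<in>S. x \<noteq> y \<longrightarrow> (x, y) \<in> parcs G) \<and>
             (\<exists>a\<in>A. is_leftmost S a)}"
proof -
  define sub where "sub S = with_proj \<lparr>pverts = S, parcs = parcs G \<inter> S \<times> S\<rparr>" for S
  have induced: "induced_subgraph H (with_proj G) \<longleftrightarrow> verts H \<subseteq> pverts G \<and> H = sub (verts H)" for H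
  proof
    assume H: "induced_subgraph H (with_proj G)"
    show "verts H \<subseteq> pverts G \<and> H = sub (verts H)"
    proof
      show "verts H \<subseteq> pverts G"
        using H by (auto simp: induced_subgraph_def subgraph_def)
      show "H = sub (verts H)"
        by (rule pre_digraph.equality)
           (use H in \<open>auto simp: induced_subgraph_def subgraph_def compatible_def sub_def\<close>)
    qed
  next
    assume H: "verts H \<subseteq> pverts G \<and> H = sub (verts H)"
    then have parts: "arcs H = parcs G \<inter> verts H \<times> verts H" "tail H = fst" "head H = snd"
      by (metis sub_def with_proj_simps pair_pre_digraph.select_convs)+
    have "wf_digraph (with_proj G)" "wf_digraph H"
      using off_diagonal by (unfold_locales; auto simp: parts)+
    then show "induced_subgraph H (with_proj G)"
      using H by (auto simp: induced_subgraph_def subgraph_def compatible_def parts)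
  qed
  have iso: "digraph_iso (sub S) \<Gamma> \<longleftrightarrow>
      card S = k \<and> (\<forall>x\<in>S. \<forall>y\<in>S. x \<noteq> y \<longrightarrow> (x, y) \<in> parcs G)" for S
  proof -
    have "digraph_iso (sub S) \<Gamma> \<longleftrightarrow>
        card S = k \<and> parcs G \<inter> S \<times> S = {(x, y). x \<in> S \<and> y \<in> S \<and> x \<noteq> y}"
      unfolding sub_def
      by (subst digraph_iso_complete_iff[OF complete \<open>k \<ge> 1\<close>]) (use off_diagonal in auto)
    then show ?thesis using off_diagonal by auto
  qed
  have [simp]: "verts (sub S) = S" for S
    by (simp add: sub_def)
  have "{H. induced_subgraph H (with_proj G) \<and> digraph_iso H \<Gamma> \<and> (\<exists>x\<in>A. is_leftmost (verts H) x)} =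
      sub ` {S. S \<subseteq> pverts G \<and> card S = k \<and> (\<forall>x\<in>S. \<forall>y\<in>S. x \<noteq> y \<longrightarrow> (x, y) \<in> parcs G) \<and>
             (\<exists>a\<in>A. is_leftmost S a)}"
    unfolding induced using iso by (auto simp: image_iff) metis+
  moreover have "inj sub"
    by (rule inj_on_inverseI[of _ verts]) simp
  ultimately show ?thesis
    unfolding induced_count_def by (simp add: card_image inj_on_subset)
qed

section \<open>Counting cliques by index sets\<close>

text \<open>
  If several indices carry the same point, only the least of them is retained. The retained indices
  are in bijection with the set of points, whether or not the points are distinct.
\<close>

definition first_indices :: "nat \<Rightarrow> (nat \<Rightarrow> 'a) \<Rightarrow> nat set" where
  "first_indices n x = {i \<in> {1..n}. \<forall>j\<in>{1..<i}. x j \<noteq> x i}"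

lemma bij_betw_first_indices: "bij_betw x (first_indices n x) (x ` {1..n})"
  unfolding bij_betw_def
proof
  show "inj_on x (first_indices n x)"
    by (rule linorder_inj_onI) (auto simp: first_indices_def)
  have "x i \<in> x ` first_indices n x" if "i \<in> {1..n}" for i
  proof -
    define j where "j = (LEAST j. j \<ge> 1 \<and> x j = x i)"
    have j: "j \<ge> 1 \<and> x j = x i" "j \<le> i"
      unfolding j_def using that by (rule_tac LeastI[of _ i], auto intro: Least_le)
    have "\<not> (l \<ge> 1 \<and> x l = x i)" if "l < j" for l
      using that unfolding j_def by (rule not_less_Least)
    then have "j \<in> first_indices n x"
      using j that by (auto simp: first_indices_def)
    then show ?thesis using j by (metis imageI)
  qed
  then show "x ` first_indices n x = x ` {1..n}"
    by (auto simp: first_indices_def)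
qed

lemma card_subsets_of_image:
  "card {S. S \<subseteq> x ` {1..n} \<and> P S} = card {I. I \<subseteq> first_indices n x \<and> P (x ` I)}"
proof -
  have inj: "inj_on x (first_indices n x)" and im: "x ` first_indices n x = x ` {1..n}"
    using bij_betw_first_indices[of x n] by (auto simp: bij_betw_def)
  have "{S. S \<subseteq> x ` {1..n} \<and> P S} = (`) x ` {I. I \<subseteq> first_indices n x \<and> P (x ` I)}"
    unfolding im[symmetric] by (auto simp: subset_image_iff)
  moreover have "inj_on ((`) x) {I. I \<subseteq> first_indices n x \<and> P (x ` I)}"
    using inj by (auto intro!: inj_onI simp: inj_on_image_eq_iff)
  ultimately show ?thesis by (simp add: card_image)
qed

definition pairwise_close :: "real \<Rightarrow> 'i set \<Rightarrow> ('i \<Rightarrow> 'a::metric_space) \<Rightarrow> bool" where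
  "pairwise_close \<rho> I x \<longleftrightarrow> (\<forall>i\<in>I. \<forall>j\<in>I. i \<noteq> j \<longrightarrow> x i \<noteq> x j \<and> dist (x i) (x j) \<le> \<rho>)"

text \<open>
  The event that the points with index in \<open>I\<close> form a clique of the geometric graph of radius \<open>\<rho>\<close>,
  rooted in \<open>A\<close>. It is stated for families over an arbitrary index type so that it applies both to the
  random points and to the integration variables of a product measure.
\<close>

definition close_rooted ::
    "(real ^ 'd::{finite,linorder}) set \<Rightarrow> real \<Rightarrow> 'i set \<Rightarrow> ('i \<Rightarrow> real ^ 'd::{finite,linorder}) \<Rightarrow> bool" where
  "close_rooted A \<rho> I x \<longleftrightarrow>
     pairwise_close \<rho> I x \<and>
     (\<exists>i\<in>I. x i \<in> A \<and> (\<forall>j\<in>I. x i $ Min UNIV \<le> x j $ Min UNIV))"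

text \<open>
  This mirrors the arcs of the percolated graph literally: if points coincide, then several coins may
  belong to the same edge. For distinct points it reduces to the coins of the pairs inside \<open>I\<close>; see
  \<open>coins_kept_inj\<close>.
\<close>

definition coins_kept :: "nat \<Rightarrow> (nat set \<Rightarrow> bool) \<Rightarrow> nat set \<Rightarrow> (nat \<Rightarrow> 'a) \<Rightarrow> bool" where
  "coins_kept n kept I x \<longleftrightarrow>
     (\<forall>i\<in>I. \<forall>j\<in>I. i \<noteq> j \<longrightarrow> (\<exists>e\<in>index_pairs n. kept e \<and> x ` e = {x i, x j}))"

lemma real_card_filter:
  assumes "finite F"
  shows "real (card {I \<in> F. P I}) = (\<Sum>I\<in>F. of_bool (P I))"
  using sum.inter_filter[OF assms, of "\<lambda>_. 1 :: real" P] by (simp add: of_bool_def)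

lemma leftmost_image:
  "(\<exists>a\<in>A. is_leftmost (x ` I) a) \<longleftrightarrow>
   (\<exists>i\<in>I. x i \<in> A \<and> (\<forall>j\<in>I. x i $ Min UNIV \<le> x j $ Min UNIV))"
  by (force simp: is_leftmost_def is_arg_min_def not_less)

text \<open>
  Both graphs under consideration have an arc between distinct points at distance at most \<open>\<rho>\<close> that
  satisfy a further relation \<open>R\<close>, which is trivial for the geometric graph and stands for the coins in
  the percolated one.
\<close>

lemma induced_count_by_indices:
  fixes x :: "nat \<Rightarrow> real ^ 'd::{finite,linorder}"
  assumes complete: "complete_digraph k \<Gamma>" and "k \<ge> 1"
    and verts: "pverts G = x ` {1..n}"
    and arcs: "parcs G = {(y, z). y \<in> x ` {1..n} \<and> z \<in> x ` {1..n} \<and> y \<noteq> z \<and> dist y z \<le> \<rho> \<and> R y z}"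
  shows "real (induced_count \<Gamma> A G) =
    (\<Sum>I | I \<subseteq> {1..n} \<and> card I = k. of_bool (I \<subseteq> first_indices n x \<and> close_rooted A \<rho> I x \<and>
        (\<forall>i\<in>I. \<forall>j\<in>I. i \<noteq> j \<longrightarrow> R (x i) (x j))))"
proof -
  have first_inj: "inj_on x I" and first_le: "I \<subseteq> {1..n}" if "I \<subseteq> first_indices n x" for I
    using that bij_betw_first_indices[of x n]
    by (auto simp: bij_betw_def inj_on_subset first_indices_def)
  have "induced_count \<Gamma> A G =
    card {S. S \<subseteq> x ` {1..n} \<and> card S = k \<and> (\<forall>y\<in>S. \<forall>z\<in>S. y \<noteq> z \<longrightarrow> (y, z) \<in> parcs G) \<and>
             (\<exists>a\<in>A. is_leftmost S a)}"
    by (subst induced_count_complete[OF complete \<open>k \<ge> 1\<close>]) (auto simp: verts arcs)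
  also have "\<dots> = card {I. I \<subseteq> first_indices n x \<and> card (x ` I) = k \<and>
      (\<forall>y\<in>x ` I. \<forall>z\<in>x ` I. y \<noteq> z \<longrightarrow> (y, z) \<in> parcs G) \<and> (\<exists>a\<in>A. is_leftmost (x ` I) a)}"
    by (rule card_subsets_of_image)
  also have "{I. I \<subseteq> first_indices n x \<and> card (x ` I) = k \<and>
      (\<forall>y\<in>x ` I. \<forall>z\<in>x ` I. y \<noteq> z \<longrightarrow> (y, z) \<in> parcs G) \<and> (\<exists>a\<in>A. is_leftmost (x ` I) a)} =
    {I \<in> {I. I \<subseteq> {1..n} \<and> card I = k}. I \<subseteq> first_indices n x \<and> close_rooted A \<rho> I x \<and>
        (\<forall>i\<in>I. \<forall>j\<in>I. i \<noteq> j \<longrightarrow> R (x i) (x j))}" (is "?L = ?R")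
  proof (rule set_eqI)
    fix I show "I \<in> ?L \<longleftrightarrow> I \<in> ?R"
    proof (cases "I \<subseteq> first_indices n x")
      case True
      note inj = first_inj[OF True] and le = first_le[OF True]
      have "(\<forall>y\<in>x ` I. \<forall>z\<in>x ` I. y \<noteq> z \<longrightarrow> (y, z) \<in> parcs G) \<longleftrightarrow>
          pairwise_close \<rho> I x \<and>
          (\<forall>i\<in>I. \<forall>j\<in>I. i \<noteq> j \<longrightarrow> R (x i) (x j))"
        using inj le by (auto simp: arcs inj_on_eq_iff subset_eq pairwise_close_def)
      moreover have "card (x ` I) = card I"
        using inj by (rule card_image)
      ultimately show ?thesis
        using True le by (auto simp: close_rooted_def leftmost_image)
    qed auto
  qed
  finally have "induced_count \<Gamma> A G = card ?R" .
  moreover have "finite {I. I \<subseteq> {1..n} \<and> card I = k}" by simp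
  ultimately show ?thesis by (simp only: real_card_filter)
qed

lemma rgg_count_by_indices:
  assumes "complete_digraph k \<Gamma>" "k \<ge> 1"
  shows "real (rgg_count \<Gamma> A X r n \<omega>) =
    (\<Sum>I | I \<subseteq> {1..n} \<and> card I = k.
       of_bool (I \<subseteq> first_indices n (\<lambda>i. X i \<omega>) \<and> close_rooted A (r n) I (\<lambda>i. X i \<omega>)))"
  unfolding rgg_count_def
  using induced_count_by_indices[OF assms, of "rgg ((\<lambda>i. X i \<omega>) ` {1..n}) (r n)" "\<lambda>i. X i \<omega>" n "r n"
      "\<lambda>_ _. True" A]
  by (simp add: rgg_def)

lemma percolated_rgg_count_by_indices:
  assumes "complete_digraph k \<Gamma>" "k \<ge> 1"
  shows "real (percolated_rgg_count \<Gamma> A X keep r n \<omega>) =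
    (\<Sum>I | I \<subseteq> {1..n} \<and> card I = k.
       of_bool (I \<subseteq> first_indices n (\<lambda>i. X i \<omega>) \<and> close_rooted A (r n) I (\<lambda>i. X i \<omega>) \<and>
                coins_kept n (\<lambda>e. keep n e \<omega>) I (\<lambda>i. X i \<omega>)))"
  unfolding percolated_rgg_count_def coins_kept_def
  by (subst induced_count_by_indices[OF assms, of _ "\<lambda>i. X i \<omega>" n "r n"
      "\<lambda>y z. \<exists>e\<in>index_pairs n. keep n e \<omega> \<and> (\<lambda>i. X i \<omega>) ` e = {y, z}" A])
     (auto simp: percolated_rgg_def rgg_def Let_def)

lemma first_indices_inj:
  assumes "inj_on x {1..n}"
  shows "first_indices n x = {1..n}"
proof -
  have "x j \<noteq> x i" if "i \<in> {1..n}" "j \<in> {1..<i}" for i j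
    using that inj_on_eq_iff[OF assms, of j i] by simp
  then show ?thesis by (auto simp: first_indices_def)
qed

lemma coins_kept_inj:
  assumes "inj_on x {1..n}" "I \<subseteq> {1..n}"
  shows "coins_kept n kept I x \<longleftrightarrow> (\<forall>e. e \<subseteq> I \<and> card e = 2 \<longrightarrow> kept e)"
proof -
  have "(\<exists>e\<in>index_pairs n. kept e \<and> x ` e = {x i, x j}) \<longleftrightarrow> kept {i, j}"
    if "i \<in> I" "j \<in> I" "i \<noteq> j" for i j
  proof -
    have ij: "{i, j} \<subseteq> {1..n}"
      using that assms by auto
    have "x ` e = {x i, x j} \<longleftrightarrow> e = {i, j}" if "e \<in> index_pairs n" for e
    proof -
      have "e \<subseteq> {1..n}"
        using that by (simp add: index_pairs_def)
      with ij have "x ` e = x ` {i, j} \<longleftrightarrow> e = {i, j}"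
        using assms(1) by (intro inj_on_image_eq_iff)
      then show ?thesis by simp
    qed
    moreover have "{i, j} \<in> index_pairs n"
      using ij that by (auto simp: index_pairs_def)
    ultimately show ?thesis by blast
  qed
  then have "coins_kept n kept I x \<longleftrightarrow> (\<forall>i\<in>I. \<forall>j\<in>I. i \<noteq> j \<longrightarrow> kept {i, j})"
    by (simp add: coins_kept_def)
  also have "\<dots> \<longleftrightarrow> (\<forall>e. e \<subseteq> I \<and> card e = 2 \<longrightarrow> kept e)"
  proof (intro iffI ballI impI allI)
    fix i j assume "\<forall>e. e \<subseteq> I \<and> card e = 2 \<longrightarrow> kept e" "i \<in> I" "j \<in> I" "i \<noteq> j"
    then show "kept {i, j}" by simp
  next
    fix e assume "\<forall>i\<in>I. \<forall>j\<in>I. i \<noteq> j \<longrightarrow> kept {i, j}" "e \<subseteq> I \<and> card e = 2"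
    then show "kept e" by (auto simp: card_2_iff)
  qed
  finally show ?thesis .
qed

text \<open>
  The point 0 gets the index 0, so that the configuration becomes a family over \<open>{..<k}\<close>, like the
  vertices of a clique.
\<close>

lemma h_fun_complete:
  assumes complete: "complete_digraph k \<Gamma>" and "k \<ge> 1"
  shows "h_fun \<Gamma> (insert 0 (z ` {1..<k})) =
     of_bool (pairwise_close 1 {..<k} (z(0 := 0)))"
proof -
  define y where "y = z(0 := 0)"
  have k: "{..<k} = insert 0 {1..<k}"
    using \<open>k \<ge> 1\<close> by auto
  have im: "insert 0 (z ` {1..<k}) = y ` {..<k}"
    unfolding k by (auto simp: y_def)
  define S where "S = y ` {..<k}"
  have off: "parcs (rgg S 1) \<subseteq>
      {(u, v). u \<in> pverts (rgg S 1) \<and> v \<in> pverts (rgg S 1) \<and> u \<noteq> v}"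
    by (auto simp: rgg_def)
  have "digraph_iso (with_proj (rgg S 1)) \<Gamma> \<longleftrightarrow>
      card S = k \<and> {(u, v). u \<in> S \<and> v \<in> S \<and> u \<noteq> v \<and> dist u v \<le> 1} = {(u, v). u \<in> S \<and> v \<in> S \<and> u \<noteq> v}"
    using digraph_iso_complete_iff[OF assms off] by (simp add: rgg_def)
  also have "\<dots> \<longleftrightarrow> card S = k \<and> (\<forall>u\<in>S. \<forall>v\<in>S. u \<noteq> v \<longrightarrow> dist u v \<le> 1)"
    by (simp add: set_eq_iff) blast
  also have "card S = k \<longleftrightarrow> inj_on y {..<k}"
    unfolding S_def using inj_on_iff_eq_card[of "{..<k}" y] by simp
  also have "inj_on y {..<k} \<and> (\<forall>u\<in>S. \<forall>v\<in>S. u \<noteq> v \<longrightarrow> dist u v \<le> 1) \<longleftrightarrow>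
      (\<forall>i\<in>{..<k}. \<forall>j\<in>{..<k}. i \<noteq> j \<longrightarrow> y i \<noteq> y j \<and> dist (y i) (y j) \<le> 1)"
  proof (intro iffI conjI ballI impI)
    fix i j assume *: "inj_on y {..<k} \<and> (\<forall>u\<in>S. \<forall>v\<in>S. u \<noteq> v \<longrightarrow> dist u v \<le> 1)"
      "i \<in> {..<k}" "j \<in> {..<k}" "i \<noteq> j"
    then show "y i \<noteq> y j"
      using inj_on_eq_iff[of y "{..<k}" i j] by simp
    with * show "dist (y i) (y j) \<le> 1" by (simp add: S_def)
  next
    assume *: "\<forall>i\<in>{..<k}. \<forall>j\<in>{..<k}. i \<noteq> j \<longrightarrow> y i \<noteq> y j \<and> dist (y i) (y j) \<le> 1"
    then show "inj_on y {..<k}"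
      by (intro inj_onI) metis
    fix u v assume "u \<in> S" "v \<in> S" "u \<noteq> v"
    then obtain i j where "i \<in> {..<k}" "j \<in> {..<k}" "u = y i" "v = y j"
      by (auto simp: S_def)
    with * \<open>u \<noteq> v\<close> show "dist u v \<le> 1" by metis
  qed
  finally show ?thesis
    unfolding im S_def[symmetric] h_fun_def y_def[symmetric] pairwise_close_def by simp
qed

lemma integral_lborel_translate:
  fixes g :: "'a::euclidean_space \<Rightarrow> real"
  assumes [measurable]: "g \<in> borel_measurable borel"
  shows "(\<integral>x. g (x + h) \<partial>lborel) = (\<integral>x. g x \<partial>lborel)"
proof -
  have "(\<integral>x. g x \<partial>lborel) = (\<integral>x. g x \<partial>distr lborel borel ((+) h))"
    by (simp add: lborel_distr_plus)
  also have "\<dots> = (\<integral>x. g (h + x) \<partial>lborel)"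
    by (rule integral_distr) auto
  finally show ?thesis by (simp add: add.commute)
qed

lemma integrable_lborel_translate:
  fixes g :: "'a::euclidean_space \<Rightarrow> real"
  assumes "integrable lborel g"
  shows "integrable lborel (\<lambda>x. g (x + h))"
proof -
  have "integrable (distr lborel borel ((+) h)) g"
    using assms by (simp add: lborel_distr_plus)
  then have "integrable lborel (\<lambda>x. g (h + x))"
    by (rule integrable_distr[rotated]) simp
  then show ?thesis by (simp add: add.commute)
qed

text \<open>
  A continuous function that is 1 on the ball of radius \<open>R\<close> and vanishes outside the ball of radius
  \<open>R + 1\<close>.
\<close>

definition cutoff :: "nat \<Rightarrow> 'a::euclidean_space \<Rightarrow> real" where
  "cutoff R x = max 0 (min 1 (real R + 1 - norm x))"

lemma cutoff_bounds: "0 \<le> cutoff R x" "cutoff R x \<le> 1" "cutoff R x \<le> indicator (cball 0 (real R + 1)) x"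
  by (auto simp: cutoff_def indicator_def)

lemma continuous_on_cutoff: "continuous_on UNIV (cutoff R)"
  unfolding cutoff_def[abs_def] by (intro continuous_intros)

lemma borel_measurable_cutoff[measurable]: "cutoff R \<in> borel_measurable borel"
  by (intro borel_measurable_continuous_onI continuous_on_cutoff)

text \<open>
  Two approximations are composed. Truncating the values of \<open>f\<close> to \<open>[-R, R]\<close> and multiplying by
  \<open>cutoff R\<close> changes \<open>f\<close> by little in \<open>L\<^sup>1\<close>, by dominated convergence with majorant \<open>2 * \<bar>f\<bar>\<close>. Being
  measurable, \<open>f\<close> is an almost everywhere limit of continuous functions \<open>g n\<close>; when these are truncated
  in the same way they are bounded with common bounded support, so that dominated convergence applies
  once more.
\<close>

lemma integrable_dense_continuous:
  fixes f :: "'a::euclidean_space \<Rightarrow> real"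
  assumes f: "integrable lborel f" and "e > 0"
  shows "\<exists>u R. continuous_on UNIV u \<and> (\<forall>x. norm x > R \<longrightarrow> u x = 0) \<and> integrable lborel u \<and>
    (\<integral>x. \<bar>f x - u x\<bar> \<partial>lborel) < e"
proof -
  have f_borel[measurable]: "f \<in> borel_measurable borel"
    using f by auto
  define clamp where "clamp R t = max (- real R) (min (real R) t)" for R t
  have clamp_cont: "continuous_on UNIV (clamp R)" for R
    unfolding clamp_def by (intro continuous_intros)
  have [measurable]: "clamp R \<in> borel_measurable borel" for R
    by (intro borel_measurable_continuous_onI clamp_cont)
  have clamp_le: "\<bar>clamp R t\<bar> \<le> \<bar>t\<bar>" "\<bar>clamp R t\<bar> \<le> real R" for R t
    by (auto simp: clamp_def)

  define fR where "fR R x = clamp R (f x) * cutoff R x" for R x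
  have fR_le: "\<bar>fR R x\<bar> \<le> \<bar>f x\<bar>" for R x
  proof -
    have "\<bar>clamp R (f x)\<bar> * cutoff R x \<le> \<bar>f x\<bar> * 1"
      using clamp_le(1) cutoff_bounds by (intro mult_mono) auto
    then show ?thesis by (simp add: fR_def abs_mult cutoff_bounds)
  qed
  have "(\<lambda>R. \<integral>x. \<bar>f x - fR R x\<bar> \<partial>lborel) \<longlonglongrightarrow> (\<integral>x. 0 \<partial>(lborel :: 'a measure))"
  proof (rule integral_dominated_convergence)
    show "(\<lambda>x. \<bar>f x - fR R x\<bar>) \<in> borel_measurable lborel" for R
      unfolding fR_def by measurable
    show "integrable lborel (\<lambda>x. 2 * \<bar>f x\<bar>)"
      using f by auto
    show "AE x in lborel. (\<lambda>R. \<bar>f x - fR R x\<bar>) \<longlonglongrightarrow> 0"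
    proof (rule AE_I2)
      fix x :: 'a
      obtain N :: nat where N: "max (norm x) \<bar>f x\<bar> \<le> real N"
        using real_arch_simple by blast
      have "\<bar>f x - fR R x\<bar> = 0" if "R \<ge> N" for R
      proof -
        have "norm x \<le> real R" "\<bar>f x\<bar> \<le> real R"
          using N that by linarith+
        then have "clamp R (f x) = f x" "cutoff R x = 1"
          by (auto simp: clamp_def cutoff_def)
        then show ?thesis by (simp add: fR_def)
      qed
      then have "\<forall>\<^sub>F R in sequentially. \<bar>f x - fR R x\<bar> = 0"
        by (auto simp: eventually_sequentially)
      then show "(\<lambda>R. \<bar>f x - fR R x\<bar>) \<longlonglongrightarrow> 0"
        by (rule tendsto_eventually)
    qed
    show "AE x in lborel. norm \<bar>f x - fR R x\<bar> \<le> 2 * \<bar>f x\<bar>" for R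
    proof (rule AE_I2)
      fix x show "norm \<bar>f x - fR R x\<bar> \<le> 2 * \<bar>f x\<bar>"
        using fR_le[of R x] by (auto simp: abs_real_def split: if_splits)
    qed
  qed auto
  then have "\<forall>\<^sub>F R in sequentially. (\<integral>x. \<bar>f x - fR R x\<bar> \<partial>lborel) < e / 2"
    using \<open>e > 0\<close> by (intro order_tendstoD) auto
  then obtain R where R: "(\<integral>x. \<bar>f x - fR R x\<bar> \<partial>lborel) < e / 2"
    by (auto simp: eventually_sequentially)

  have "f measurable_on UNIV"
    using f_borel by (subst measurable_on_iff_borel_measurable) (auto simp: lebesgue_on_UNIV_eq intro: measurable_completion)
  then obtain N g where "negligible N" and g: "\<And>n. continuous_on UNIV (g n)"
    and lim: "\<And>x. x \<notin> N \<Longrightarrow> (\<lambda>n. g n x) \<longlonglongrightarrow> f x"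
    by (auto simp: measurable_on_def)
  have "N \<in> null_sets lebesgue"
    using \<open>negligible N\<close> by (simp add: negligible_iff_null_sets)
  then have "AE x in lebesgue. x \<notin> N"
    by (rule AE_not_in)
  then have "AE x in lebesgue. (\<lambda>n. g n x) \<longlonglongrightarrow> f x"
    by eventually_elim (rule lim)
  then have AE_lim: "AE x in lborel. (\<lambda>n. g n x) \<longlonglongrightarrow> f x"
    by (simp add: AE_completion_iff)
  have [measurable]: "g n \<in> borel_measurable borel" for n
    by (intro borel_measurable_continuous_onI g)
  have [measurable]: "fR R \<in> borel_measurable borel" for R
    unfolding fR_def by measurable
  define u where "u n x = clamp R (g n x) * cutoff R x" for n x
  have u_cont: "continuous_on UNIV (u n)" for n
    unfolding u_def
    by (intro continuous_intros continuous_on_cutoff continuous_on_compose2[OF clamp_cont g]) auto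
  have [measurable]: "u n \<in> borel_measurable borel" for n
    by (intro borel_measurable_continuous_onI u_cont)
  have bd: "\<bar>clamp R t * cutoff R x\<bar> \<le> real R * indicator (cball 0 (real R + 1)) x" for t and x :: 'a
    using clamp_le(2)[of R t] cutoff_bounds[of R x] by (auto simp: abs_mult intro!: mult_mono)
  have int_ind: "integrable lborel (\<lambda>x. c * indicator (cball (0::'a) (real R + 1)) x :: real)" for c
    by (auto intro!: integrable_real_indicator emeasure_lborel_cball_finite)
  have u_int: "integrable lborel (u n)" for n
    by (rule Bochner_Integration.integrable_bound[OF int_ind[of R]])
       (use bd in \<open>auto simp: u_def abs_mult\<close>)
  have fR_int: "integrable lborel (fR R)"
    by (rule Bochner_Integration.integrable_bound[OF int_ind[of R]])
       (use bd in \<open>auto simp: fR_def abs_mult\<close>)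
  have "(\<lambda>n. \<integral>x. \<bar>fR R x - u n x\<bar> \<partial>lborel) \<longlonglongrightarrow> (\<integral>x. 0 \<partial>(lborel :: 'a measure))"
  proof (rule integral_dominated_convergence)
    show "integrable lborel (\<lambda>x. 2 * real R * indicator (cball (0::'a) (real R + 1)) x)"
      by (rule int_ind)
    show "AE x in lborel. (\<lambda>n. \<bar>fR R x - u n x\<bar>) \<longlonglongrightarrow> 0"
      using AE_lim
    proof eventually_elim
      case (elim x)
      have "(\<lambda>n. clamp R (g n x)) \<longlonglongrightarrow> clamp R (f x)"
        unfolding clamp_def by (intro tendsto_intros elim)
      then have "(\<lambda>n. \<bar>fR R x - u n x\<bar>) \<longlonglongrightarrow> \<bar>fR R x - fR R x\<bar>"
        unfolding fR_def u_def by (intro tendsto_intros)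
      then show ?case by simp
    qed
    show "AE x in lborel. norm \<bar>fR R x - u n x\<bar> \<le> 2 * real R * indicator (cball 0 (real R + 1)) x" for n
    proof (rule AE_I2)
      fix x
      show "norm \<bar>fR R x - u n x\<bar> \<le> 2 * real R * indicator (cball 0 (real R + 1)) x"
        using bd[of "f x" x] bd[of "g n x" x] by (simp add: fR_def u_def)
    qed
    show "(\<lambda>x. \<bar>fR R x - u n x\<bar>) \<in> borel_measurable lborel" for n
      unfolding fR_def by measurable
  qed auto
  then have "\<forall>\<^sub>F n in sequentially. (\<integral>x. \<bar>fR R x - u n x\<bar> \<partial>lborel) < e / 2"
    using \<open>e > 0\<close> by (intro order_tendstoD) auto
  then obtain n where n: "(\<integral>x. \<bar>fR R x - u n x\<bar> \<partial>lborel) < e / 2"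
    by (auto simp: eventually_sequentially)
  have "(\<integral>x. \<bar>f x - u n x\<bar> \<partial>lborel) \<le> (\<integral>x. \<bar>f x - fR R x\<bar> + \<bar>fR R x - u n x\<bar> \<partial>lborel)"
    using f u_int fR_int by (intro integral_mono) auto
  also have "\<dots> = (\<integral>x. \<bar>f x - fR R x\<bar> \<partial>lborel) + (\<integral>x. \<bar>fR R x - u n x\<bar> \<partial>lborel)"
    using f u_int fR_int by (intro Bochner_Integration.integral_add) auto
  also have "\<dots> < e" using R n by simp
  finally have "(\<integral>x. \<bar>f x - u n x\<bar> \<partial>lborel) < e" .
  moreover have "\<forall>x. norm x > real R + 1 \<longrightarrow> u n x = 0"
    by (auto simp: u_def cutoff_def)
  ultimately show ?thesis using u_cont u_int by blast
qed

text \<open>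
  For a continuous function of bounded support this is dominated convergence; the general case follows
  by approximation, because a translation does not change the \<open>L\<^sup>1\<close> distance of two functions.
\<close>

lemma translation_continuous_L1:
  fixes f :: "'a::euclidean_space \<Rightarrow> real"
  assumes f: "integrable lborel f" and h: "h \<longlonglongrightarrow> 0"
  shows "(\<lambda>n. \<integral>x. \<bar>f (x + h n) - f x\<bar> \<partial>lborel) \<longlonglongrightarrow> 0"
proof (rule tendstoI)
  fix e :: real assume "e > 0"
  have [measurable]: "f \<in> borel_measurable borel"
    using f by auto
  from integrable_dense_continuous[OF f, of "e / 3"] \<open>e > 0\<close>
  obtain u R where u_cont: "continuous_on UNIV u" and supp: "\<And>x. norm x > R \<Longrightarrow> u x = 0"
    and u_int: "integrable lborel u" and close: "(\<integral>x. \<bar>f x - u x\<bar> \<partial>lborel) < e / 3"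
    by auto
  have [measurable]: "u \<in> borel_measurable borel"
    using u_int by auto
  have "Bseq h"
    using h by (intro convergent_imp_Bseq convergentI)
  then obtain H where H: "\<And>n. norm (h n) \<le> H"
    by (auto simp: Bseq_def)
  have "bounded (u ` cball 0 R)"
    using u_cont by (intro compact_imp_bounded compact_continuous_image)
      (auto intro: continuous_on_subset)
  then obtain C0 where C0: "\<And>x. norm x \<le> R \<Longrightarrow> \<bar>u x\<bar> \<le> C0"
    unfolding bounded_iff by fastforce
  define C where "C = max 0 C0"
  have C: "\<bar>u x\<bar> \<le> C" "0 \<le> C" for x
    using C0[of x] supp[of x] by (cases "norm x \<le> R"; auto simp: C_def)+
  have "(\<lambda>n. \<integral>x. \<bar>u (x + h n) - u x\<bar> \<partial>lborel) \<longlonglongrightarrow> (\<integral>x. 0 \<partial>(lborel :: 'a measure))"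
  proof (rule integral_dominated_convergence)
    \<comment> \<open>Both \<open>u\<close> and its translates by the \<open>h n\<close>, of norm at most \<open>H\<close>, vanish outside this ball.\<close>
    show "integrable lborel (\<lambda>x. 2 * C * indicator (cball (0::'a) (R + H)) x)"
      by (auto intro!: integrable_real_indicator emeasure_lborel_cball_finite)
    show "AE x in lborel. (\<lambda>n. \<bar>u (x + h n) - u x\<bar>) \<longlonglongrightarrow> 0"
    proof (rule AE_I2)
      fix x
      have "isCont u (x + 0)"
        using u_cont by (simp add: continuous_on_eq_continuous_at)
      moreover have "(\<lambda>n. x + h n) \<longlonglongrightarrow> x + 0"
        by (intro tendsto_intros h)
      ultimately have "(\<lambda>n. u (x + h n)) \<longlonglongrightarrow> u (x + 0)"
        by (rule isCont_tendsto_compose)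
      then have "(\<lambda>n. \<bar>u (x + h n) - u x\<bar>) \<longlonglongrightarrow> \<bar>u (x + 0) - u x\<bar>"
        by (intro tendsto_intros)
      then show "(\<lambda>n. \<bar>u (x + h n) - u x\<bar>) \<longlonglongrightarrow> 0" by simp
    qed
    show "AE x in lborel. norm \<bar>u (x + h n) - u x\<bar> \<le> 2 * C * indicator (cball 0 (R + H)) x" for n
    proof (rule AE_I2)
      fix x
      show "norm \<bar>u (x + h n) - u x\<bar> \<le> 2 * C * indicator (cball 0 (R + H)) x"
      proof (cases "norm x \<le> R + H")
        case True
        then show ?thesis
          using C(1)[of "x + h n"] C(1)[of x] by auto
      next
        case False
        moreover have "norm x \<le> norm (x + h n) + norm (h n)"
          using norm_triangle_ineq4[of "x + h n" "h n"] by simp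
        moreover have "0 \<le> H"
          using H[of n] norm_ge_zero[of "h n"] by linarith
        ultimately have "norm (x + h n) > R" "norm x > R"
          using H[of n] by linarith+
        then show ?thesis using supp C(2) by simp
      qed
    qed
  qed auto
  then have "\<forall>\<^sub>F n in sequentially. (\<integral>x. \<bar>u (x + h n) - u x\<bar> \<partial>lborel) < e / 3"
    using \<open>e > 0\<close> by (intro order_tendstoD) auto
  then show "\<forall>\<^sub>F n in sequentially. dist (\<integral>x. \<bar>f (x + h n) - f x\<bar> \<partial>lborel) 0 < e"
  proof eventually_elim
    case (elim n)
    note int = f u_int integrable_lborel_translate[OF f, of "h n"] integrable_lborel_translate[OF u_int, of "h n"]
    have "(\<integral>x. \<bar>f (x + h n) - f x\<bar> \<partial>lborel) \<le>
        (\<integral>x. \<bar>f (x + h n) - u (x + h n)\<bar> + \<bar>u (x + h n) - u x\<bar> + \<bar>f x - u x\<bar> \<partial>lborel)"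
      using int by (intro integral_mono) auto
    also have "\<dots> = (\<integral>x. \<bar>f (x + h n) - u (x + h n)\<bar> \<partial>lborel) + (\<integral>x. \<bar>u (x + h n) - u x\<bar> \<partial>lborel) +
        (\<integral>x. \<bar>f x - u x\<bar> \<partial>lborel)"
      using int by simp
    also have "(\<integral>x. \<bar>f (x + h n) - u (x + h n)\<bar> \<partial>lborel) = (\<integral>x. \<bar>f x - u x\<bar> \<partial>lborel)"
      by (rule integral_lborel_translate) simp
    finally have "(\<integral>x. \<bar>f (x + h n) - f x\<bar> \<partial>lborel) < e"
      using elim close by simp
    moreover have "0 \<le> (\<integral>x. \<bar>f (x + h n) - f x\<bar> \<partial>lborel)"
      by simp
    ultimately show ?case by simp
  qed
qed

text \<open>
  This is the bound \<open>norm_prod_diff\<close> for factors in the unit ball, rescaled by \<open>C\<close>.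
\<close>

lemma abs_prod_diff_le:
  fixes a b :: "'i \<Rightarrow> real"
  assumes "C > 0" and "\<And>i. i \<in> I \<Longrightarrow> \<bar>a i\<bar> \<le> C" "\<And>i. i \<in> I \<Longrightarrow> \<bar>b i\<bar> \<le> C"
  shows "\<bar>(\<Prod>i\<in>I. a i) - (\<Prod>i\<in>I. b i)\<bar> \<le> C ^ card I * (\<Sum>i\<in>I. \<bar>a i - b i\<bar> / C)"
proof -
  have scale: "(\<Prod>i\<in>I. c i) = C ^ card I * (\<Prod>i\<in>I. c i / C)" for c :: "'i \<Rightarrow> real"
    using \<open>C > 0\<close> by (simp add: prod_dividef)
  have "\<bar>(\<Prod>i\<in>I. a i) - (\<Prod>i\<in>I. b i)\<bar> = C ^ card I * \<bar>(\<Prod>i\<in>I. a i / C) - (\<Prod>i\<in>I. b i / C)\<bar>"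
    using \<open>C > 0\<close> by (subst (1 2) scale) (simp add: abs_mult flip: right_diff_distrib)
  also have "\<bar>(\<Prod>i\<in>I. a i / C) - (\<Prod>i\<in>I. b i / C)\<bar> \<le> (\<Sum>i\<in>I. \<bar>a i / C - b i / C\<bar>)"
    using norm_prod_diff[of I "\<lambda>i. a i / C" "\<lambda>i. b i / C"] assms by simp
  also have "(\<Sum>i\<in>I. \<bar>a i / C - b i / C\<bar>) = (\<Sum>i\<in>I. \<bar>a i - b i\<bar> / C)"
    using \<open>C > 0\<close> by (simp flip: diff_divide_distrib)
  finally show ?thesis using \<open>C > 0\<close> by simp
qed

section \<open>Products of translates of a density\<close>

lemma integrable_prod_translates:
  fixes f :: "'a::euclidean_space \<Rightarrow> real"
  assumes f: "integrable lborel f" and bound: "\<And>x. 0 \<le> f x" "\<And>x. f x \<le> C"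
    and K: "finite K" "K \<noteq> {}"
  shows "integrable lborel (\<lambda>x. \<Prod>i\<in>K. f (x + h i))"
proof -
  obtain j where j: "j \<in> K" using K by auto
  have [measurable]: "f \<in> borel_measurable borel"
    using f by auto
  show ?thesis
  proof (rule Bochner_Integration.integrable_bound)
    show "integrable lborel (\<lambda>x. C ^ (card K - 1) * f (x + h j))"
      using integrable_lborel_translate[OF f, of "h j"] by auto
    show "AE x in lborel. norm (\<Prod>i\<in>K. f (x + h i)) \<le> norm (C ^ (card K - 1) * f (x + h j))"
    proof (rule AE_I2)
      fix x
      have "(\<Prod>i\<in>K - {j}. f (x + h i)) \<le> (\<Prod>i\<in>K - {j}. C)"
        using bound by (intro prod_mono) auto
      then have "(\<Prod>i\<in>K - {j}. f (x + h i)) \<le> C ^ (card K - 1)"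
        using j by simp
      then have "f (x + h j) * (\<Prod>i\<in>K - {j}. f (x + h i)) \<le> f (x + h j) * C ^ (card K - 1)"
        using bound(1) by (rule mult_left_mono)
      then have le: "(\<Prod>i\<in>K. f (x + h i)) \<le> C ^ (card K - 1) * f (x + h j)"
        using K j by (simp add: prod.remove mult.commute)
      have "0 \<le> (\<Prod>i\<in>K. f (x + h i))"
        using bound by (intro prod_nonneg) auto
      with le show "norm (\<Prod>i\<in>K. f (x + h i)) \<le> norm (C ^ (card K - 1) * f (x + h j))"
        by simp
    qed
  qed measurable
qed

text \<open>
  The difference of the two integrands is at most a constant times the sum of the
  \<open>\<bar>f (x + r n *\<^sub>R y i) - f x\<bar>\<close>, which vanishes in the limit by \<open>L\<^sup>1\<close> continuity of translations, plus
  \<open>f x ^ card K\<close> times the difference of the indicators. The latter is eventually 0 for every \<open>x\<close>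
  off the frontier of \<open>A\<close>: a point of the open set \<open>A\<close> stays in \<open>A\<close> under small translations, and a
  point outside the closure stays outside. The set \<open>L\<close> will consist of the indices of left-most points;
  it must not be empty, for otherwise no point of \<open>A\<close> would be hit.
\<close>

lemma tendsto_prod_translates:
  fixes f :: "'a::euclidean_space \<Rightarrow> real"
  assumes f: "integrable lborel f" and bound: "\<And>x. 0 \<le> f x" "\<And>x. f x \<le> C"
    and A: "open A" "emeasure lborel (frontier A) = 0"
    and K: "finite K" "K \<noteq> {}" and L: "L \<subseteq> K" "L \<noteq> {}"
    and r: "r \<longlonglongrightarrow> 0"
  shows "(\<lambda>n. \<integral>x. (\<Prod>i\<in>K. f (x + r n *\<^sub>R y i)) * of_bool (\<exists>i\<in>L. x + r n *\<^sub>R y i \<in> A) \<partial>lborel)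
     \<longlonglongrightarrow> (\<integral>x. f x ^ card K * indicator A x \<partial>lborel)"
proof -
  \<comment> \<open>The bound on differences of products divides by the bound on the factors, so it must not be 0.\<close>
  define C' where "C' = max 1 C"
  have C': "C' > 0" "\<bar>f x\<bar> \<le> C'" for x
    using bound[of x] by (auto simp: C'_def)
  have [measurable]: "f \<in> borel_measurable borel"
    using f by auto
  have [measurable]: "A \<in> sets borel"
    using A by auto
  have L_fin: "finite L"
    using K L finite_subset by blast
  define P where "P t x = (\<Prod>i\<in>K. f (x + t *\<^sub>R y i))" for t x
  define hit where "hit t x = (of_bool (\<exists>i\<in>L. x + t *\<^sub>R y i \<in> A) :: real)" for t x
  define S where "S t x = (\<Sum>i\<in>K. \<bar>f (x + t *\<^sub>R y i) - f x\<bar>)" for t x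
  have [measurable]: "P t \<in> borel_measurable borel" "hit t \<in> borel_measurable borel" "S t \<in> borel_measurable borel" for t
    unfolding P_def[abs_def] hit_def[abs_def] S_def[abs_def] using L_fin by measurable
  have diff: "\<bar>P t x - f x ^ card K\<bar> \<le> C' ^ card K / C' * S t x" for t x
    using abs_prod_diff_le[of C' K "\<lambda>i. f (x + t *\<^sub>R y i)" "\<lambda>_. f x"] C'
    by (simp add: P_def S_def sum_divide_distrib[symmetric] prod_constant)
  have int_S: "integrable lborel (S t)" for t
    unfolding S_def by (intro Bochner_Integration.integrable_sum integrable_abs Bochner_Integration.integrable_diff
        integrable_lborel_translate f)
  have int_pow: "integrable lborel (\<lambda>x. f x ^ card K)"
    using integrable_prod_translates[OF f bound K, of "\<lambda>_. 0"] by simp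
  have int_P: "integrable lborel (P t)" for t
    using integrable_prod_translates[OF f bound K, of "\<lambda>i. t *\<^sub>R y i"] by (simp add: P_def[abs_def])
  have hit_le: "\<bar>hit t x\<bar> \<le> 1" "\<bar>hit t x - indicator A x\<bar> \<le> 1" for t x
    by (auto simp: hit_def indicator_def)
  have lim_S: "(\<lambda>n. \<integral>x. S (r n) x \<partial>lborel) \<longlonglongrightarrow> 0"
  proof -
    have "(\<lambda>n. \<integral>x. \<bar>f (x + r n *\<^sub>R y i) - f x\<bar> \<partial>lborel) \<longlonglongrightarrow> 0" for i
    proof (rule translation_continuous_L1[OF f])
      show "(\<lambda>n. r n *\<^sub>R y i) \<longlonglongrightarrow> 0"
        using tendsto_scaleR[OF r tendsto_const, of "y i"] by simp
    qed
    then have "(\<lambda>n. \<Sum>i\<in>K. \<integral>x. \<bar>f (x + r n *\<^sub>R y i) - f x\<bar> \<partial>lborel) \<longlonglongrightarrow> (\<Sum>i\<in>K. 0)"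
      by (intro tendsto_sum) auto
    moreover have "(\<integral>x. S (r n) x \<partial>lborel) = (\<Sum>i\<in>K. \<integral>x. \<bar>f (x + r n *\<^sub>R y i) - f x\<bar> \<partial>lborel)" for n
      unfolding S_def by (intro Bochner_Integration.integral_sum integrable_abs Bochner_Integration.integrable_diff
        integrable_lborel_translate f)
    ultimately show ?thesis by simp
  qed
  have lim_hit: "(\<lambda>n. \<integral>x. f x ^ card K * \<bar>hit (r n) x - indicator A x\<bar> \<partial>lborel) \<longlonglongrightarrow> (\<integral>x. 0 \<partial>(lborel :: 'a measure))"
  proof (rule integral_dominated_convergence[OF _ _ int_pow])
    have "frontier A \<in> null_sets lborel"
      using A by (intro null_setsI) (auto simp: frontier_def)
    then have "AE x in lborel. x \<notin> frontier A"
      by (rule AE_not_in)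
    then show "AE x in lborel. (\<lambda>n. f x ^ card K * \<bar>hit (r n) x - indicator A x\<bar>) \<longlonglongrightarrow> 0"
    proof eventually_elim
      case (elim x)
      have tend: "(\<lambda>n. x + r n *\<^sub>R y i) \<longlonglongrightarrow> x" for i
        using tendsto_add[OF tendsto_const[of x] tendsto_scaleR[OF r tendsto_const[of "y i"]]] by simp
      have "\<forall>\<^sub>F n in sequentially. hit (r n) x = indicator A x"
      proof (cases "x \<in> A")
        case True
        obtain i where "i \<in> L" using L by auto
        have "\<forall>\<^sub>F n in sequentially. x + r n *\<^sub>R y i \<in> A"
          using topological_tendstoD[OF tend A(1) True] .
        then show ?thesis
          by eventually_elim (use \<open>i \<in> L\<close> True in \<open>auto simp: hit_def\<close>)
      next
        case False
        with elim A(1) have "x \<in> - closure A"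
          by (auto simp: frontier_def interior_open)
        have "\<forall>\<^sub>F n in sequentially. x + r n *\<^sub>R y i \<in> - closure A" for i
          by (rule topological_tendstoD[OF tend _ \<open>x \<in> - closure A\<close>]) auto
        then have "\<forall>\<^sub>F n in sequentially. \<forall>i\<in>L. x + r n *\<^sub>R y i \<in> - closure A"
          using L_fin by (simp add: eventually_ball_finite)
        then show ?thesis
          by eventually_elim (use False closure_subset[of A] in \<open>auto simp: hit_def\<close>)
      qed
      then have "\<forall>\<^sub>F n in sequentially. f x ^ card K * \<bar>hit (r n) x - indicator A x\<bar> = 0"
        by eventually_elim simp
      then show ?case by (rule tendsto_eventually)
    qed
    show "AE x in lborel. norm (f x ^ card K * \<bar>hit (r n) x - indicator A x\<bar>) \<le> f x ^ card K" for n
    proof (rule AE_I2)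
      fix x
      show "norm (f x ^ card K * \<bar>hit (r n) x - indicator A x\<bar>) \<le> f x ^ card K"
        using bound(1)[of x] hit_le(2)[of "r n" x] by (simp add: abs_mult mult_left_le)
    qed
  qed auto
  have int_Phit: "integrable lborel (\<lambda>x. P t x * hit t x)" for t
    by (rule Bochner_Integration.integrable_bound[OF int_P[of t]])
       (use hit_le in \<open>auto simp: abs_mult mult_left_le\<close>)
  have int_pow_A: "integrable lborel (\<lambda>x. f x ^ card K * indicator A x)"
    by (rule Bochner_Integration.integrable_bound[OF int_pow]) (auto simp: indicator_def)
  have int_pow_hit: "integrable lborel (\<lambda>x. f x ^ card K * \<bar>hit t x - indicator A x\<bar>)" for t
    by (rule Bochner_Integration.integrable_bound[OF int_pow])
       (use hit_le in \<open>auto simp: abs_mult mult_left_le\<close>)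
  have "(\<lambda>n. (\<integral>x. P (r n) x * hit (r n) x \<partial>lborel) - (\<integral>x. f x ^ card K * indicator A x \<partial>lborel)) \<longlonglongrightarrow> 0"
  proof (rule Lim_null_comparison)
    show "(\<lambda>n. C' ^ card K / C' * (\<integral>x. S (r n) x \<partial>lborel) +
        (\<integral>x. f x ^ card K * \<bar>hit (r n) x - indicator A x\<bar> \<partial>lborel)) \<longlonglongrightarrow> 0"
      using tendsto_add[OF tendsto_mult[OF tendsto_const[of "C' ^ card K / C'"] lim_S] lim_hit] by simp
    have "norm ((\<integral>x. P t x * hit t x \<partial>lborel) - (\<integral>x. f x ^ card K * indicator A x \<partial>lborel)) \<le>
        C' ^ card K / C' * (\<integral>x. S t x \<partial>lborel) + (\<integral>x. f x ^ card K * \<bar>hit t x - indicator A x\<bar> \<partial>lborel)" for t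
    proof -
      have "norm ((\<integral>x. P t x * hit t x \<partial>lborel) - (\<integral>x. f x ^ card K * indicator A x \<partial>lborel)) =
          norm (\<integral>x. P t x * hit t x - f x ^ card K * indicator A x \<partial>lborel)"
        using int_Phit int_pow_A by simp
      also have "\<dots> \<le> (\<integral>x. norm (P t x * hit t x - f x ^ card K * indicator A x) \<partial>lborel)"
        by (rule integral_norm_bound)
      also have "\<dots> \<le> (\<integral>x. C' ^ card K / C' * S t x + f x ^ card K * \<bar>hit t x - indicator A x\<bar> \<partial>lborel)"
      proof (rule integral_mono)
        show "integrable lborel (\<lambda>x. norm (P t x * hit t x - f x ^ card K * indicator A x))"
          using int_Phit int_pow_A by auto
        show "integrable lborel (\<lambda>x. C' ^ card K / C' * S t x + f x ^ card K * \<bar>hit t x - indicator A x\<bar>)"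
          using int_S int_pow_hit by auto
        fix x
        have "P t x * hit t x - f x ^ card K * indicator A x =
            (P t x - f x ^ card K) * hit t x + f x ^ card K * (hit t x - indicator A x)"
          by (simp add: algebra_simps)
        also have "norm \<dots> \<le> norm ((P t x - f x ^ card K) * hit t x) +
            norm (f x ^ card K * (hit t x - indicator A x))"
          by (rule norm_triangle_ineq)
        also have "norm ((P t x - f x ^ card K) * hit t x) \<le> \<bar>P t x - f x ^ card K\<bar>"
          using hit_le(1)[of t x] by (simp add: abs_mult mult_left_le)
        also have "norm (f x ^ card K * (hit t x - indicator A x)) = f x ^ card K * \<bar>hit t x - indicator A x\<bar>"
          using bound(1)[of x] by (simp add: abs_mult)
        finally show "norm (P t x * hit t x - f x ^ card K * indicator A x) \<le>
            C' ^ card K / C' * S t x + f x ^ card K * \<bar>hit t x - indicator A x\<bar>"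
          using diff[of t x] by simp
      qed
      also have "\<dots> = C' ^ card K / C' * (\<integral>x. S t x \<partial>lborel) + (\<integral>x. f x ^ card K * \<bar>hit t x - indicator A x\<bar> \<partial>lborel)"
        using int_S int_pow_hit by simp
      finally show ?thesis .
    qed
    then show "\<forall>\<^sub>F n in sequentially. norm ((\<integral>x. P (r n) x * hit (r n) x \<partial>lborel) -
        (\<integral>x. f x ^ card K * indicator A x \<partial>lborel)) \<le> C' ^ card K / C' * (\<integral>x. S (r n) x \<partial>lborel) +
        (\<integral>x. f x ^ card K * \<bar>hit (r n) x - indicator A x\<bar> \<partial>lborel)"
      by (intro always_eventually allI)
  qed
  then show "(\<lambda>n. \<integral>x. (\<Prod>i\<in>K. f (x + r n *\<^sub>R y i)) * of_bool (\<exists>i\<in>L. x + r n *\<^sub>R y i \<in> A) \<partial>lborel)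
     \<longlonglongrightarrow> (\<integral>x. f x ^ card K * indicator A x \<partial>lborel)"
    by (simp add: P_def hit_def LIM_zero_iff)
qed

section \<open>Product measures\<close>

lemma PiM_density:
  fixes f :: "'a::euclidean_space \<Rightarrow> ennreal"
  assumes "finite K" and [measurable]: "f \<in> borel_measurable borel"
    and "sigma_finite_measure (density lborel f)"
  shows "(\<Pi>\<^sub>M i\<in>K. density lborel f) = density (\<Pi>\<^sub>M i\<in>K. lborel) (\<lambda>x. \<Prod>i\<in>K. f (x i))"
proof -
  interpret lb: product_sigma_finite "\<lambda>_. lborel :: 'a::euclidean_space measure"
    by standard
  interpret sigma_finite_measure "density lborel f" by fact
  interpret D: product_sigma_finite "\<lambda>_. density lborel f"
    by standard
  show ?thesis
  proof (rule D.PiM_eqI[symmetric, OF \<open>finite K\<close>])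
    show "sets (density (\<Pi>\<^sub>M i\<in>K. lborel) (\<lambda>x. \<Prod>i\<in>K. f (x i))) = sets (\<Pi>\<^sub>M i\<in>K. density lborel f)"
      by (simp cong: sets_PiM_cong)
    fix E :: "'b \<Rightarrow> 'a set" assume E: "\<And>i. i \<in> K \<Longrightarrow> E i \<in> sets (density lborel f)"
    then have [measurable]: "Pi\<^sub>E K E \<in> sets (\<Pi>\<^sub>M i\<in>K. lborel)"
      using \<open>finite K\<close> by (intro sets_PiM_I_finite) auto
    have "emeasure (density (\<Pi>\<^sub>M i\<in>K. lborel) (\<lambda>x. \<Prod>i\<in>K. f (x i))) (Pi\<^sub>E K E) =
        (\<integral>\<^sup>+x. (\<Prod>i\<in>K. f (x i)) * indicator (Pi\<^sub>E K E) x \<partial>(\<Pi>\<^sub>M i\<in>K. lborel))"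
      by (rule emeasure_density) measurable
    also have "\<dots> = (\<integral>\<^sup>+x. (\<Prod>i\<in>K. f (x i) * indicator (E i) (x i)) \<partial>(\<Pi>\<^sub>M i\<in>K. lborel))"
      using \<open>finite K\<close>
      by (intro nn_integral_cong) (auto simp: prod.distrib space_PiM PiE_iff indicator_def prod_zero_iff)
    also have "\<dots> = (\<Prod>i\<in>K. \<integral>\<^sup>+x. f x * indicator (E i) x \<partial>lborel)"
      using E \<open>finite K\<close> by (intro lb.product_nn_integral_prod) auto
    also have "\<dots> = (\<Prod>i\<in>K. emeasure (density lborel f) (E i))"
      using E by (intro prod.cong) (auto simp: emeasure_density)
    finally show "emeasure (density (\<Pi>\<^sub>M i\<in>K. lborel) (\<lambda>x. \<Prod>i\<in>K. f (x i))) (Pi\<^sub>E K E) =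
        (\<Prod>i\<in>K. emeasure (density lborel f) (E i))" .
  qed
qed

text \<open>
  On a box, the factor \<open>c ^ DIM('a)\<close> arises once for each coordinate; boxes determine the product
  measure.
\<close>

lemma nn_integral_PiM_lborel_affine:
  fixes t :: "'a::euclidean_space"
  assumes "finite J" and c: "c > 0" and [measurable]: "G \<in> borel_measurable (\<Pi>\<^sub>M i\<in>J. lborel)"
  shows "(\<integral>\<^sup>+y. G y \<partial>(\<Pi>\<^sub>M i\<in>J. lborel)) =
    ennreal (c ^ (DIM('a) * card J)) * (\<integral>\<^sup>+z. G (\<lambda>i\<in>J. t + c *\<^sub>R z i) \<partial>(\<Pi>\<^sub>M i\<in>J. lborel))"
proof -
  interpret lb: product_sigma_finite "\<lambda>_. lborel :: 'a measure"
    by standard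
  define T where "T z = (\<lambda>i\<in>J. t + c *\<^sub>R z i)" for z :: "'b \<Rightarrow> 'a"
  define P where "P = (\<Pi>\<^sub>M i\<in>J. (lborel :: 'a measure))"
  define s where "s = ennreal (c ^ (DIM('a) * card J))"
  have [measurable]: "T \<in> measurable P P"
    unfolding T_def[abs_def] P_def by measurable
  have G[measurable]: "G \<in> borel_measurable P"
    unfolding P_def by measurable
  have "P = density (distr P P T) (\<lambda>_. s)"
    unfolding P_def
  proof (rule lb.PiM_eqI[symmetric, OF \<open>finite J\<close>])
    fix E :: "'b \<Rightarrow> 'a set" assume E: "\<And>i. i \<in> J \<Longrightarrow> E i \<in> sets lborel"
    then have PE: "Pi\<^sub>E J E \<in> sets P"
      unfolding P_def using \<open>finite J\<close> by (intro sets_PiM_I_finite) auto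
    let ?E' = "\<lambda>i. (\<lambda>x. t + c *\<^sub>R x) -` E i"
    have E': "?E' i \<in> sets lborel" if "i \<in> J" for i
      using E[OF that] measurable_sets_borel[of "\<lambda>x. t + c *\<^sub>R x" borel "E i"] by simp
    have scale: "emeasure lborel (E i) = ennreal (c ^ DIM('a)) * emeasure lborel (?E' i)" if "i \<in> J" for i
    proof -
      have "emeasure lborel (E i) =
          emeasure (density (distr lborel borel (\<lambda>x. t + c *\<^sub>R x)) (\<lambda>_. \<bar>c\<bar>^DIM('a))) (E i)"
        using lborel_affine[of c t] c by simp
      also have "\<dots> = ennreal (c ^ DIM('a)) * emeasure (distr lborel borel (\<lambda>x. t + c *\<^sub>R x)) (E i)"
        using E[OF that] c by (simp add: emeasure_density nn_integral_cmult_indicator)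
      also have "emeasure (distr lborel borel (\<lambda>x. t + c *\<^sub>R x)) (E i) = emeasure lborel (?E' i)"
        using E[OF that] by (simp add: emeasure_distr)
      finally show ?thesis .
    qed
    have "emeasure (density (distr P P T) (\<lambda>_. s)) (Pi\<^sub>E J E) = s * emeasure (distr P P T) (Pi\<^sub>E J E)"
      using PE by (simp add: emeasure_density nn_integral_cmult_indicator)
    also have "emeasure (distr P P T) (Pi\<^sub>E J E) = emeasure P (T -` Pi\<^sub>E J E \<inter> space P)"
      using PE by (simp add: emeasure_distr)
    also have "T -` Pi\<^sub>E J E \<inter> space P = Pi\<^sub>E J ?E'"
      by (auto simp: T_def P_def space_PiM PiE_iff)
    also have "emeasure P (Pi\<^sub>E J ?E') = (\<Prod>i\<in>J. emeasure lborel (?E' i))"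
      unfolding P_def using \<open>finite J\<close> E' by (rule lb.emeasure_PiM)
    also have "s * \<dots> = (\<Prod>i\<in>J. ennreal (c ^ DIM('a)) * emeasure lborel (?E' i))"
      using c by (simp add: s_def prod.distrib prod_constant ennreal_power power_mult)
    also have "\<dots> = (\<Prod>i\<in>J. emeasure lborel (E i))"
      by (intro prod.cong refl scale[symmetric])
    finally show "emeasure (density (distr (Pi\<^sub>M J (\<lambda>_. lborel)) (Pi\<^sub>M J (\<lambda>_. lborel)) T) (\<lambda>_. s)) (Pi\<^sub>E J E) =
        (\<Prod>i\<in>J. emeasure lborel (E i))"
      by (simp add: P_def)
  qed (simp add: P_def)
  then have "(\<integral>\<^sup>+y. G y \<partial>P) = (\<integral>\<^sup>+y. G y \<partial>density (distr P P T) (\<lambda>_. s))"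
    by simp
  also have "\<dots> = s * (\<integral>\<^sup>+z. G (T z) \<partial>P)"
    by (simp add: nn_integral_density nn_integral_cmult nn_integral_distr)
  finally show ?thesis
    by (simp add: P_def s_def T_def)
qed

section \<open>The probability of a rooted clique at small scale\<close>

lemma measurable_pairwise_close:
  fixes Y :: "'i \<Rightarrow> 'w \<Rightarrow> 'a::euclidean_space"
  assumes [measurable]: "finite I" "\<And>i. i \<in> I \<Longrightarrow> Y i \<in> borel_measurable M"
  shows "Measurable.pred M (\<lambda>\<omega>. pairwise_close \<rho> I (\<lambda>i. Y i \<omega>))"
  unfolding pairwise_close_def by measurable

lemma measurable_close_rooted:
  fixes Y :: "'i \<Rightarrow> 'w \<Rightarrow> real ^ 'd::{finite,linorder}"
  assumes [measurable]: "finite I" "\<And>i. i \<in> I \<Longrightarrow> Y i \<in> borel_measurable M" "A \<in> sets borel"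
  shows "Measurable.pred M (\<lambda>\<omega>. close_rooted A \<rho> I (\<lambda>i. Y i \<omega>))"
proof -
  have [measurable]: "(\<lambda>\<omega>. Y i \<omega> $ m) \<in> borel_measurable M" if "i \<in> I" for i m
    using assms(2)[OF that] by (rule measurable_compose) (rule borel_measurable_nth)
  note measurable_pairwise_close[OF assms(1,2), measurable]
  show ?thesis
    unfolding close_rooted_def by measurable
qed

text \<open>
  Closeness scales along with the configuration, and which points are left-most is unaffected by an
  affine map with positive factor; only membership in \<open>A\<close> still depends on \<open>t\<close> and \<open>c\<close>.
\<close>

lemma close_rooted_affine:
  assumes "c > 0"
  shows "close_rooted A (c * \<rho>) I (\<lambda>i. t + c *\<^sub>R y i) \<longleftrightarrow>
    pairwise_close \<rho> I y \<and>
    (\<exists>i\<in>{i\<in>I. \<forall>j\<in>I. y i $ Min UNIV \<le> y j $ Min UNIV}. t + c *\<^sub>R y i \<in> A)"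
proof -
  have "dist (t + c *\<^sub>R u) (t + c *\<^sub>R v) = c * dist u v" for u v :: "real ^ 'a::{finite,linorder}"
    using assms by (simp add: dist_norm flip: scaleR_diff_right)
  then show ?thesis
    using assms unfolding close_rooted_def pairwise_close_def by auto
qed

lemma close_rooted_cong:
  "(\<And>i. i \<in> I \<Longrightarrow> x i = y i) \<Longrightarrow> close_rooted A \<rho> I x \<longleftrightarrow> close_rooted A \<rho> I y"
  unfolding close_rooted_def pairwise_close_def by simp

lemma close_rooted_reindex:
  assumes "bij_betw \<sigma> K I"
  shows "close_rooted A \<rho> I x \<longleftrightarrow> close_rooted A \<rho> K (\<lambda>i. x (\<sigma> i))"
proof -
  have I: "I = \<sigma> ` K" and inj: "\<And>i j. i \<in> K \<Longrightarrow> j \<in> K \<Longrightarrow> \<sigma> i = \<sigma> j \<longleftrightarrow> i = j"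
    using assms by (auto simp: bij_betw_def inj_on_eq_iff)
  have "pairwise_close \<rho> I x \<longleftrightarrow> pairwise_close \<rho> K (\<lambda>i. x (\<sigma> i))"
    unfolding pairwise_close_def I using inj by simp
  then show ?thesis
    unfolding close_rooted_def by (simp add: I)
qed

text \<open>
  The integrand, as a function of the position \<open>t\<close> of the first point, that remains after the
  substitution \<open>x\<^sub>i = t + c y\<^sub>i\<close> once the factor for closeness, which depends on \<open>y\<close> only, is split off.
\<close>

definition root_density ::
    "(real ^ 'd::{finite,linorder} \<Rightarrow> real) \<Rightarrow> (real ^ 'd::{finite,linorder}) set \<Rightarrow> nat \<Rightarrow> real
       \<Rightarrow> (nat \<Rightarrow> real ^ 'd::{finite,linorder}) \<Rightarrow> real ^ 'd::{finite,linorder} \<Rightarrow> real" where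
  "root_density f A k c y t = (\<Prod>i<k. f (t + c *\<^sub>R y i)) *
     of_bool (\<exists>i\<in>{i\<in>{..<k}. \<forall>j\<in>{..<k}. y i $ Min UNIV \<le> y j $ Min UNIV}. t + c *\<^sub>R y i \<in> A)"

lemma measurable_root_density:
  fixes f :: "real ^ 'd::{finite,linorder} \<Rightarrow> real"
  assumes [measurable]: "f \<in> borel_measurable borel" "A \<in> sets borel"
    and Y[measurable]: "\<And>i. i < k \<Longrightarrow> Y i \<in> borel_measurable N" and [measurable]: "T \<in> borel_measurable N"
  shows "(\<lambda>w. root_density f A k c (\<lambda>i. Y i w) (T w)) \<in> borel_measurable N"
proof -
  have [measurable]: "(\<lambda>w. Y i w $ m) \<in> borel_measurable N" if "i \<in> {..<k}" for i m
    using Y[of i] that by (intro measurable_compose[OF _ borel_measurable_nth]) simp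
  have [measurable]: "Y i \<in> borel_measurable N" if "i \<in> {..<k}" for i
    using Y that by simp
  have "(\<exists>i\<in>{i\<in>{..<k}. \<forall>j\<in>{..<k}. Y i w $ Min UNIV \<le> Y j w $ Min UNIV}. T w + c *\<^sub>R Y i w \<in> A) \<longleftrightarrow>
      (\<exists>i\<in>{..<k}. (\<forall>j\<in>{..<k}. Y i w $ Min UNIV \<le> Y j w $ Min UNIV) \<and> T w + c *\<^sub>R Y i w \<in> A)" for w
    by blast
  then show ?thesis
    unfolding root_density_def by simp
qed

lemma
  fixes f :: "real ^ 'd::{finite,linorder} \<Rightarrow> real"
  assumes f: "integrable lborel f" and total: "(\<integral>x. f x \<partial>lborel) = 1"
    and bound: "\<And>x. 0 \<le> f x" "\<And>x. f x \<le> C"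
    and A[measurable]: "A \<in> sets borel" and "k \<ge> 1"
  shows integrable_root_density: "integrable lborel (root_density f A k c y)"
    and root_density_nonneg: "0 \<le> root_density f A k c y t"
    and integral_root_density_le:
      "y 0 = 0 \<Longrightarrow> (\<integral>t. root_density f A k c y t \<partial>lborel) \<le> C ^ (k - 1)"
proof -
  let ?P = "\<lambda>t. \<Prod>i<k. f (t + c *\<^sub>R y i)"
  have nonneg: "0 \<le> ?P t" for t
    using bound by (intro prod_nonneg) auto
  then show "0 \<le> root_density f A k c y t" for t
    by (simp add: root_density_def)
  have le: "root_density f A k c y t \<le> ?P t" for t
    using nonneg[of t] by (simp add: root_density_def mult_left_le)
  have "integrable lborel ?P"
    using \<open>k \<ge> 1\<close> by (intro integrable_prod_translates[OF f bound]) (auto simp: lessThan_empty_iff)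
  then show int: "integrable lborel (root_density f A k c y)"
  proof (rule Bochner_Integration.integrable_bound)
    have [measurable]: "f \<in> borel_measurable borel" using f by auto
    show "root_density f A k c y \<in> borel_measurable lborel"
      using measurable_root_density[of f A k "\<lambda>i _. y i" lborel "\<lambda>t. t" c] by simp
    show "AE t in lborel. norm (root_density f A k c y t) \<le> norm (?P t)"
      using le nonneg by (auto simp: root_density_def abs_mult)
  qed
  assume "y 0 = 0"
  have "(\<integral>t. root_density f A k c y t \<partial>lborel) \<le> (\<integral>t. C ^ (k - 1) * f t \<partial>lborel)"
  proof (rule integral_mono[OF int])
    show "integrable lborel (\<lambda>t. C ^ (k - 1) * f t)" using f by auto
    fix t
    have k: "{..<k} = insert 0 {1..<k}" using \<open>k \<ge> 1\<close> by auto
    have "root_density f A k c y t \<le> ?P t"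
      by (rule le)
    also have "\<dots> = f t * (\<Prod>i\<in>{1..<k}. f (t + c *\<^sub>R y i))"
      unfolding k using \<open>y 0 = 0\<close> by simp
    also have "\<dots> \<le> f t * C ^ (k - 1)"
    proof (rule mult_left_mono[OF _ bound(1)])
      have "(\<Prod>i\<in>{1..<k}. f (t + c *\<^sub>R y i)) \<le> (\<Prod>i\<in>{1..<k}. C)"
        using bound by (intro prod_mono) auto
      then show "(\<Prod>i\<in>{1..<k}. f (t + c *\<^sub>R y i)) \<le> C ^ (k - 1)" by simp
    qed
    finally show "root_density f A k c y t \<le> C ^ (k - 1) * f t"
      by (simp add: mult.commute)
  qed
  also have "\<dots> = C ^ (k - 1)" using total by simp
  finally show "(\<integral>t. root_density f A k c y t \<partial>lborel) \<le> C ^ (k - 1)" .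
qed

text \<open>
  The product measure over \<open>{1..<k}\<close> carries the relative positions \<open>z\<close>, and \<open>z(0 := 0)\<close> adds the
  base point as a further coordinate.
\<close>

lemma measurable_PiM_base_point:
  fixes N :: "(nat \<Rightarrow> 'a::euclidean_space) measure"
  assumes "i < k" and N: "sets N = sets (\<Pi>\<^sub>M i\<in>{1..<k}. lborel)"
  shows "(\<lambda>z. (z(0 := 0)) i) \<in> borel_measurable N"
proof (cases "i = 0")
  case False
  then have "(\<lambda>z. z i) \<in> measurable (\<Pi>\<^sub>M i\<in>{1..<k}. lborel :: 'a measure) lborel"
    using assms by (intro measurable_component_singleton) auto
  then show ?thesis
    using False N by (simp cong: measurable_cong_sets)
qed simp

definition rooted_prob ::
    "(real ^ 'd::{finite,linorder} \<Rightarrow> real) \<Rightarrow> (real ^ 'd::{finite,linorder}) set \<Rightarrow> nat \<Rightarrow> real \<Rightarrow> real" where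
  "rooted_prob f A k \<rho> = measure (\<Pi>\<^sub>M i\<in>{..<k}. density lborel (\<lambda>x. ennreal (f x)))
     {x \<in> space (\<Pi>\<^sub>M i\<in>{..<k}. density lborel (\<lambda>x. ennreal (f x))). close_rooted A \<rho> {..<k} x}"

locale bounded_density =
  fixes f :: "real ^ 'd::{finite,linorder} \<Rightarrow> real" and C :: real
  assumes density_borel[measurable]: "f \<in> borel_measurable borel"
    and density_nonneg: "0 \<le> f x" and density_le: "f x \<le> C"
    and density_total: "(\<integral>\<^sup>+x. ennreal (f x) \<partial>lborel) = 1"
begin

lemma integrable_f: "integrable lborel f"
  by (rule integrableI_bounded) (auto simp: density_nonneg density_total)

lemma integral_f: "(\<integral>x. f x \<partial>lborel) = 1"
  using density_total by (subst integral_eq_nn_integral) (auto simp: density_nonneg)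

lemma prob_space_f: "prob_space (density lborel (\<lambda>x. ennreal (f x)))"
  by (rule prob_spaceI) (simp add: emeasure_density density_total)

text \<open>
  Both integrands vanish unless all \<open>z i\<close> are within distance 1 of the base point 0. This confines \<open>z\<close>
  to a product of unit balls, a set of finite measure.
\<close>

lemma
  assumes A[measurable]: "A \<in> sets borel" and "k \<ge> 1"
  shows integrable_integral_root_density: "integrable (\<Pi>\<^sub>M i\<in>{1..<k}. lborel)
      (\<lambda>z. of_bool (pairwise_close 1 {..<k} (z(0 := 0))) * (\<integral>t. root_density f A k c (z(0 := 0)) t \<partial>lborel))"
    and integrable_pairwise_close: "integrable (\<Pi>\<^sub>M i\<in>{1..<k}. lborel)
      (\<lambda>z. D * of_bool (pairwise_close 1 {..<k} (z(0 := 0 :: real ^ 'd::{finite,linorder}))) :: real)"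
proof -
  interpret lb: product_sigma_finite "\<lambda>_. lborel :: (real ^ 'd::{finite,linorder}) measure"
    by standard
  let ?P = "\<Pi>\<^sub>M i\<in>{1..<k}. (lborel :: (real ^ 'd::{finite,linorder}) measure)"
  define B where "B = Pi\<^sub>E {1..<k} (\<lambda>_. cball (0 :: real ^ 'd::{finite,linorder}) 1)"
  have B[measurable]: "B \<in> sets ?P"
    unfolding B_def by (intro sets_PiM_I_finite) auto
  have "emeasure ?P B = (\<Prod>i\<in>{1..<k}. emeasure lborel (cball (0 :: real ^ 'd::{finite,linorder}) 1))"
    unfolding B_def by (rule lb.emeasure_PiM) auto
  also have "emeasure lborel (cball (0 :: real ^ 'd::{finite,linorder}) 1) =
      ennreal (measure lborel (cball (0 :: real ^ 'd::{finite,linorder}) 1))"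
    using emeasure_lborel_cball_finite[of "0 :: real ^ 'd::{finite,linorder}" 1]
    by (intro emeasure_eq_ennreal_measure) auto
  finally have fin: "emeasure ?P B < \<infinity>"
    by (simp add: ennreal_power)
  then have int_B: "integrable ?P (\<lambda>z. D * indicator B z :: real)" for D
    by (intro integrable_mult_right integrable_real_indicator B fin)
  have [measurable]: "Measurable.pred ?P (\<lambda>z. pairwise_close 1 {..<k} (z(0 := 0)))"
    using measurable_pairwise_close[of "{..<k}" "\<lambda>i z. (z(0 := 0)) i" ?P 1] measurable_PiM_base_point[of _ k ?P]
    by (simp del: fun_upd_apply)
  have sub: "z \<in> B" if "z \<in> space ?P" "pairwise_close 1 {..<k} (z(0 := 0))" for z
  proof -
    have "norm (z i) \<le> 1" if "i \<in> {1..<k}" for i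
    proof -
      have "i \<in> {..<k}" "0 \<in> {..<k}" "i \<noteq> 0" using that by auto
      then have "dist ((z(0 := 0)) i) ((z(0 := 0)) 0) \<le> 1"
        using \<open>pairwise_close 1 {..<k} (z(0 := 0))\<close> unfolding pairwise_close_def by blast
      then show ?thesis using \<open>i \<noteq> 0\<close> by simp
    qed
    with that show ?thesis by (auto simp: B_def space_PiM PiE_iff)
  qed
  show "integrable ?P (\<lambda>z. D * of_bool (pairwise_close 1 {..<k} (z(0 := 0))) :: real)"
  proof (rule Bochner_Integration.integrable_bound[OF int_B[of D]])
    show "AE z in ?P. norm (D * of_bool (pairwise_close 1 {..<k} (z(0 := 0)))) \<le> norm (D * indicator B z)"
      using sub by (intro AE_I2) (auto simp: abs_mult)
  qed measurable
  have "0 \<le> C" using density_nonneg[of 0] density_le[of 0] by linarith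
  have base: "(\<lambda>z. root_density f A k c ((fst z)(0 := 0)) (snd z)) \<in> borel_measurable (?P \<Otimes>\<^sub>M lborel)"
  proof (rule measurable_root_density)
    fix i assume "i < k"
    show "(\<lambda>z. ((fst z)(0 := 0)) i) \<in> borel_measurable (?P \<Otimes>\<^sub>M lborel)"
      by (rule measurable_compose[OF measurable_fst measurable_PiM_base_point[OF \<open>i < k\<close> refl]])
  qed auto
  have [measurable]: "(\<lambda>z. \<integral>t. root_density f A k c (z(0 := 0)) t \<partial>lborel) \<in> borel_measurable ?P"
    by (rule sigma_finite_measure.borel_measurable_lebesgue_integral[OF sigma_finite_lborel])
       (use base in \<open>simp add: split_beta\<close>)
  show "integrable ?P
      (\<lambda>z. of_bool (pairwise_close 1 {..<k} (z(0 := 0))) * (\<integral>t. root_density f A k c (z(0 := 0)) t \<partial>lborel))"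
  proof (rule Bochner_Integration.integrable_bound[OF int_B[of "C ^ (k - 1)"]])
    show "AE z in ?P. norm (of_bool (pairwise_close 1 {..<k} (z(0 := 0))) *
        (\<integral>t. root_density f A k c (z(0 := 0)) t \<partial>lborel)) \<le> norm (C ^ (k - 1) * indicator B z :: real)"
    proof (rule AE_I2)
      fix z assume "z \<in> space ?P"
      have "0 \<le> (\<integral>t. root_density f A k c (z(0 := 0)) t \<partial>lborel)"
        using root_density_nonneg[OF integrable_f integral_f density_nonneg density_le A \<open>k \<ge> 1\<close>]
        by (intro Bochner_Integration.integral_nonneg) auto
      moreover have "(\<integral>t. root_density f A k c (z(0 := 0)) t \<partial>lborel) \<le> C ^ (k - 1)"
        by (rule integral_root_density_le[OF integrable_f integral_f density_nonneg density_le A \<open>k \<ge> 1\<close>]) simp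
      ultimately show "norm (of_bool (pairwise_close 1 {..<k} (z(0 := 0))) *
        (\<integral>t. root_density f A k c (z(0 := 0)) t \<partial>lborel)) \<le> norm (C ^ (k - 1) * indicator B z :: real)"
        using sub[OF \<open>z \<in> space ?P\<close>] \<open>0 \<le> C\<close> by (auto simp: abs_mult)
    qed
  qed measurable
qed

text \<open>
  The coordinate \<open>x\<^sub>0\<close> is integrated last, the others are replaced by \<open>x\<^sub>0 + \<rho> z\<^sub>i\<close>, and the order of
  integration is then exchanged so that \<open>x\<^sub>0\<close> becomes the inner variable.
\<close>

lemma rooted_prob_rescaled:
  assumes A[measurable]: "A \<in> sets borel" and "k \<ge> 1" and \<rho>: "\<rho> > 0"
  shows "rooted_prob f A k \<rho> = \<rho> ^ (CARD('d) * (k - 1)) *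
    (\<integral>z. of_bool (pairwise_close 1 {..<k} (z(0 := 0))) * (\<integral>t. root_density f A k \<rho> (z(0 := 0)) t \<partial>lborel)
       \<partial>(\<Pi>\<^sub>M i\<in>{1..<k}. lborel))"
proof -
  interpret lb: product_sigma_finite "\<lambda>_. lborel :: (real ^ 'd::{finite,linorder}) measure"
    by standard
  interpret D: prob_space "density lborel (\<lambda>x. ennreal (f x))"
    by (rule prob_space_f)
  define J where "J = {1..<k}"
  let ?PK = "\<Pi>\<^sub>M i\<in>{..<k}. (lborel :: (real ^ 'd::{finite,linorder}) measure)"
  let ?PJ = "\<Pi>\<^sub>M i\<in>J. (lborel :: (real ^ 'd::{finite,linorder}) measure)"
  interpret J: finite_product_sigma_finite "\<lambda>_. lborel :: (real ^ 'd::{finite,linorder}) measure" J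
    by standard (simp add: J_def)
  interpret pair: pair_sigma_finite ?PJ "lborel :: (real ^ 'd::{finite,linorder}) measure" ..
  have K: "{..<k} = insert 0 J" and J: "finite J" "0 \<notin> J" "card J = k - 1"
    using \<open>k \<ge> 1\<close> by (auto simp: J_def)
  define G where "G z t = ennreal (of_bool (pairwise_close 1 {..<k} (z(0 := 0))) * root_density f A k \<rho> (z(0 := 0)) t)"
    for z t
  note int = integrable_root_density[OF integrable_f integral_f density_nonneg density_le A \<open>k \<ge> 1\<close>]
  note nonneg = root_density_nonneg[OF integrable_f integral_f density_nonneg density_le A \<open>k \<ge> 1\<close>]
  have [measurable (raw)]: "(\<lambda>w. G (Z w) (T w)) \<in> borel_measurable N"
    if "Z \<in> measurable N ?PJ" and [measurable]: "T \<in> borel_measurable N"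
    for Z T and N :: "'n measure"
  proof -
    have Z[measurable]: "(\<lambda>w. ((Z w)(0 := 0)) i) \<in> borel_measurable N" if "i < k" for i
      by (rule measurable_compose[OF \<open>Z \<in> measurable N ?PJ\<close> measurable_PiM_base_point[OF that]])
         (simp only: J_def)
    have [measurable]: "Measurable.pred N (\<lambda>w. pairwise_close 1 {..<k} ((Z w)(0 := 0)))"
      using measurable_pairwise_close[of "{..<k}" "\<lambda>i w. ((Z w)(0 := 0)) i" N 1] Z by (simp del: fun_upd_apply)
    have [measurable]: "(\<lambda>w. root_density f A k \<rho> ((Z w)(0 := 0)) (T w)) \<in> borel_measurable N"
      using measurable_root_density[of f A k "\<lambda>i w. ((Z w)(0 := 0)) i" N T \<rho>] Z by (simp del: fun_upd_apply)
    show ?thesis unfolding G_def by measurable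
  qed
  define S where "S = {x \<in> space ?PK. close_rooted A \<rho> {..<k} x}"
  define F where "F x = ennreal ((\<Prod>i<k. f (x i)) * of_bool (close_rooted A \<rho> {..<k} x))" for x
  have pred[measurable]: "Measurable.pred ?PK (close_rooted A \<rho> {..<k})"
    using measurable_close_rooted[of "{..<k}" "\<lambda>i x. x i" ?PK A \<rho>] by simp
  have S[measurable]: "S \<in> sets ?PK"
    unfolding S_def by measurable
  have F[measurable]: "F \<in> borel_measurable ?PK"
    unfolding F_def by measurable
  have F': "F \<in> borel_measurable (Pi\<^sub>M (insert 0 J) (\<lambda>_. lborel))"
    using F by (simp add: K)
  have dens: "(\<Pi>\<^sub>M i\<in>{..<k}. density lborel (\<lambda>x. ennreal (f x))) = density ?PK (\<lambda>x. \<Prod>i<k. ennreal (f (x i)))"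
    by (rule PiM_density) (auto simp: D.sigma_finite_measure_axioms)
  have "emeasure (\<Pi>\<^sub>M i\<in>{..<k}. density lborel (\<lambda>x. ennreal (f x))) S =
      (\<integral>\<^sup>+x. (\<Prod>i<k. ennreal (f (x i))) * indicator S x \<partial>?PK)"
    unfolding dens by (rule emeasure_density) measurable
  also have "\<dots> = (\<integral>\<^sup>+x. F x \<partial>?PK)"
    by (intro nn_integral_cong) (auto simp: F_def S_def prod_ennreal density_nonneg indicator_def)
  also have "\<dots> = (\<integral>\<^sup>+t. \<integral>\<^sup>+y. F (y(0 := t)) \<partial>?PJ \<partial>lborel)"
    unfolding K using J F' by (intro lb.product_nn_integral_insert_rev) auto
  also have "\<dots> = (\<integral>\<^sup>+t. ennreal (\<rho> ^ (CARD('d) * (k - 1))) *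
      (\<integral>\<^sup>+z. F ((\<lambda>i\<in>J. t + \<rho> *\<^sub>R z i)(0 := t)) \<partial>?PJ) \<partial>lborel)"
  proof (rule nn_integral_cong)
    fix t :: "real ^ 'd::{finite,linorder}"
    have "(\<lambda>y. y(0 := t)) \<in> measurable ?PJ (Pi\<^sub>M (insert 0 J) (\<lambda>_. lborel))"
      by (intro measurable_fun_upd[where J=J]) auto
    then have "(\<lambda>y. F (y(0 := t))) \<in> borel_measurable ?PJ"
      using F' by (rule measurable_compose)
    from nn_integral_PiM_lborel_affine[OF J(1) \<rho> this, of t]
    show "(\<integral>\<^sup>+y. F (y(0 := t)) \<partial>?PJ) = ennreal (\<rho> ^ (CARD('d) * (k - 1))) *
      (\<integral>\<^sup>+z. F ((\<lambda>i\<in>J. t + \<rho> *\<^sub>R z i)(0 := t)) \<partial>?PJ)"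
      using J by simp
  qed
  also have "\<dots> = (\<integral>\<^sup>+t. ennreal (\<rho> ^ (CARD('d) * (k - 1))) *
      (\<integral>\<^sup>+z. ennreal (of_bool (pairwise_close 1 {..<k} (z(0 := 0))) * root_density f A k \<rho> (z(0 := 0)) t) \<partial>?PJ) \<partial>lborel)"
  proof (intro nn_integral_cong arg_cong2[where f = "(*)"] refl)
    fix t :: "real ^ 'd::{finite,linorder}" and z :: "nat \<Rightarrow> real ^ 'd::{finite,linorder}"
    define y where "y = z(0 := 0)"
    let ?x = "(\<lambda>i\<in>J. t + \<rho> *\<^sub>R z i)(0 := t)"
    have x: "?x i = t + \<rho> *\<^sub>R y i" if "i \<in> {..<k}" for i
      using that by (auto simp: y_def K)
    have "close_rooted A \<rho> {..<k} ?x \<longleftrightarrow> close_rooted A (\<rho> * 1) {..<k} (\<lambda>i. t + \<rho> *\<^sub>R y i)"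
      unfolding mult_1_right using x by (rule close_rooted_cong)
    also note close_rooted_affine[OF \<rho>]
    finally have "F ?x = ennreal ((\<Prod>i<k. f (t + \<rho> *\<^sub>R y i)) * of_bool (pairwise_close 1 {..<k} y \<and>
        (\<exists>i\<in>{i\<in>{..<k}. \<forall>j\<in>{..<k}. y i $ Min UNIV \<le> y j $ Min UNIV}. t + \<rho> *\<^sub>R y i \<in> A)))"
      unfolding F_def using prod.cong[OF refl, of "{..<k}" "\<lambda>i. f (?x i)" "\<lambda>i. f (t + \<rho> *\<^sub>R y i)"] x by simp
    then show "F ?x = ennreal (of_bool (pairwise_close 1 {..<k} (z(0 := 0))) * root_density f A k \<rho> (z(0 := 0)) t)"
      unfolding root_density_def y_def[symmetric] of_bool_conj by (simp add: mult_ac)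
  qed
  also have "\<dots> = ennreal (\<rho> ^ (CARD('d) * (k - 1))) * (\<integral>\<^sup>+t. (\<integral>\<^sup>+z. G z t \<partial>?PJ) \<partial>lborel)"
    unfolding G_def[symmetric] by (intro nn_integral_cmult) measurable
  also have "(\<integral>\<^sup>+t. (\<integral>\<^sup>+z. G z t \<partial>?PJ) \<partial>lborel) = (\<integral>\<^sup>+z. (\<integral>\<^sup>+t. G z t \<partial>lborel) \<partial>?PJ)"
    by (rule pair.Fubini') measurable
  also have "\<dots> = (\<integral>\<^sup>+z. ennreal (of_bool (pairwise_close 1 {..<k} (z(0 := 0))) *
      (\<integral>t. root_density f A k \<rho> (z(0 := 0)) t \<partial>lborel)) \<partial>?PJ)"
  proof (rule nn_integral_cong)
    fix z :: "nat \<Rightarrow> real ^ 'd::{finite,linorder}"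
    have "(\<integral>\<^sup>+t. G z t \<partial>lborel) =
        ennreal (\<integral>t. of_bool (pairwise_close 1 {..<k} (z(0 := 0))) * root_density f A k \<rho> (z(0 := 0)) t \<partial>lborel)"
      unfolding G_def
      by (rule nn_integral_eq_integral) (auto simp: nonneg int)
    then show "(\<integral>\<^sup>+t. G z t \<partial>lborel) = ennreal (of_bool (pairwise_close 1 {..<k} (z(0 := 0))) *
      (\<integral>t. root_density f A k \<rho> (z(0 := 0)) t \<partial>lborel))"
      by simp
  qed
  also have "\<dots> = ennreal (\<integral>z. of_bool (pairwise_close 1 {..<k} (z(0 := 0))) *
      (\<integral>t. root_density f A k \<rho> (z(0 := 0)) t \<partial>lborel) \<partial>?PJ)"
    using integrable_integral_root_density[OF A \<open>k \<ge> 1\<close>, of \<rho>] unfolding J_def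
    by (rule nn_integral_eq_integral) (auto intro!: AE_I2 mult_nonneg_nonneg Bochner_Integration.integral_nonneg nonneg)
  finally have "emeasure (\<Pi>\<^sub>M i\<in>{..<k}. density lborel (\<lambda>x. ennreal (f x))) S =
      ennreal (\<rho> ^ (CARD('d) * (k - 1)) * (\<integral>z. of_bool (pairwise_close 1 {..<k} (z(0 := 0))) *
      (\<integral>t. root_density f A k \<rho> (z(0 := 0)) t \<partial>lborel) \<partial>?PJ))"
    using \<rho> by (simp add: ennreal_mult' )
  moreover have "space (\<Pi>\<^sub>M i\<in>{..<k}. density lborel (\<lambda>x. ennreal (f x))) = space ?PK"
    by (simp add: space_PiM)
  ultimately show ?thesis
    using \<rho> unfolding rooted_prob_def S_def[symmetric] J_def measure_def
    by (simp add: S_def)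
       (subst enn2real_ennreal, auto intro!: mult_nonneg_nonneg Bochner_Integration.integral_nonneg nonneg)
qed

text \<open>
  For fixed \<open>z\<close> the inner integral converges by \<open>tendsto_prod_translates\<close>, to a limit that does not
  depend on \<open>z\<close>; it is bounded by \<open>C ^ (k - 1)\<close>, because one of the \<open>k\<close> factors is the density at the
  base point itself, whose integral is 1.
\<close>

lemma rooted_prob_limit:
  assumes "open A" "emeasure lborel (frontier A) = 0" and "k \<ge> 1"
    and r: "r \<longlonglongrightarrow> 0" and r_pos: "\<And>n. n \<ge> 1 \<Longrightarrow> 0 < r n"
  shows "(\<lambda>n. rooted_prob f A k (r n) / r n ^ (CARD('d) * (k - 1))) \<longlonglongrightarrow>
    (\<integral>x. f x ^ k * indicator A x \<partial>lborel) *
    (\<integral>z. of_bool (pairwise_close 1 {..<k} (z(0 := 0 :: real ^ 'd::{finite,linorder}))) \<partial>(\<Pi>\<^sub>M i\<in>{1..<k}. lborel))"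
proof -
  let ?P = "\<Pi>\<^sub>M i\<in>{1..<k}. (lborel :: (real ^ 'd::{finite,linorder}) measure)"
  define I where "I c z = (\<integral>t. root_density f A k c (z(0 := 0)) t \<partial>lborel)" for c z
  define q where "q z = (of_bool (pairwise_close 1 {..<k} (z(0 := 0 :: real ^ 'd::{finite,linorder}))) :: real)" for z
  define m where "m = (\<integral>x. f x ^ k * indicator A x \<partial>lborel)"
  have A: "A \<in> sets borel" using \<open>open A\<close> by simp
  have I_lim: "(\<lambda>n. I (r n) z) \<longlonglongrightarrow> m" for z
  proof -
    define y where "y = z(0 := 0)"
    define L where "L = {i\<in>{..<k}. \<forall>j\<in>{..<k}. y i $ Min UNIV \<le> y j $ Min UNIV}"
    have K: "finite {..<k}" "{..<k} \<noteq> {}" using \<open>k \<ge> 1\<close> by (auto simp: lessThan_empty_iff)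
    \<comment> \<open>A finite configuration has a left-most point.\<close>
    have "Min ((\<lambda>i. y i $ Min UNIV) ` {..<k}) \<in> (\<lambda>i. y i $ Min UNIV) ` {..<k}"
      using K by (intro Min_in) auto
    then obtain i where "i \<in> {..<k}" "y i $ Min UNIV = Min ((\<lambda>i. y i $ Min UNIV) ` {..<k})"
      by (metis (no_types, lifting) imageE)
    then have "i \<in> L"
      by (auto simp: L_def)
    then have L: "L \<subseteq> {..<k}" "L \<noteq> {}"
      by (auto simp: L_def)
    from tendsto_prod_translates[OF integrable_f density_nonneg density_le assms(1,2) K L r, of y]
    show ?thesis
      unfolding I_def root_density_def y_def[symmetric] L_def[symmetric] m_def by simp
  qed
  have int_q: "integrable ?P (\<lambda>z. D * q z)" for D
    unfolding q_def by (rule integrable_pairwise_close[OF A \<open>k \<ge> 1\<close>])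
  have int_I: "integrable ?P (\<lambda>z. q z * I c z)" for c
    unfolding q_def I_def by (rule integrable_integral_root_density[OF A \<open>k \<ge> 1\<close>])
  have "(\<lambda>n. \<integral>z. q z * I (r n) z \<partial>?P) \<longlonglongrightarrow> (\<integral>z. q z * m \<partial>?P)"
  proof (rule integral_dominated_convergence[OF _ _ int_q[of "C ^ (k - 1)"]])
    show "AE z in ?P. (\<lambda>n. q z * I (r n) z) \<longlonglongrightarrow> q z * m"
      by (intro AE_I2 tendsto_intros I_lim)
    show "AE z in ?P. norm (q z * I (r n) z) \<le> C ^ (k - 1) * q z" for n
    proof (rule AE_I2)
      fix z
      have "0 \<le> I (r n) z" unfolding I_def
        by (intro Bochner_Integration.integral_nonneg
          root_density_nonneg[OF integrable_f integral_f density_nonneg density_le A \<open>k \<ge> 1\<close>])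
      moreover have "I (r n) z \<le> C ^ (k - 1)" unfolding I_def
        by (rule integral_root_density_le[OF integrable_f integral_f density_nonneg density_le A \<open>k \<ge> 1\<close>]) simp
      ultimately show "norm (q z * I (r n) z) \<le> C ^ (k - 1) * q z"
        by (simp add: q_def)
    qed
    show "(\<lambda>z. q z * I (r n) z) \<in> borel_measurable ?P" for n
      using int_I by auto
    show "(\<lambda>z. q z * m) \<in> borel_measurable ?P"
      using int_q[of m] by (auto simp: mult.commute)
  qed
  moreover have "rooted_prob f A k (r n) / r n ^ (CARD('d) * (k - 1)) = (\<integral>z. q z * I (r n) z \<partial>?P)" if "n \<ge> 1" for n
    using rooted_prob_rescaled[OF A \<open>k \<ge> 1\<close> r_pos[OF that]] r_pos[OF that] by (simp add: q_def I_def)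
  then have "\<forall>\<^sub>F n in sequentially. (\<integral>z. q z * I (r n) z \<partial>?P) = rooted_prob f A k (r n) / r n ^ (CARD('d) * (k - 1))"
    by (intro eventually_sequentiallyI[of 1]) simp
  ultimately have "(\<lambda>n. rooted_prob f A k (r n) / r n ^ (CARD('d) * (k - 1))) \<longlonglongrightarrow> (\<integral>z. q z * m \<partial>?P)"
    by (rule Lim_transform_eventually)
  then show ?thesis
    by (simp add: m_def q_def mult.commute)
qed

end

section \<open>Random points and coins\<close>

lemma Int_stable_events_of: "Int_stable (events_of M N Y)"
proof (rule Int_stableI)
  fix a b assume "a \<in> events_of M N Y" "b \<in> events_of M N Y"
  then obtain S T where "S \<in> sets N" "T \<in> sets N" "a = Y -` S \<inter> space M" "b = Y -` T \<inter> space M"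
    by (auto simp: events_of_def)
  then show "a \<inter> b \<in> events_of M N Y"
    unfolding events_of_def by (intro CollectI exI[of _ "S \<inter> T"]) auto
qed

lemma measurable_neq:
  fixes u v :: "'w \<Rightarrow> 'a::euclidean_space"
  assumes "u \<in> borel_measurable N" "v \<in> borel_measurable N"
  shows "Measurable.pred N (\<lambda>x. u x \<noteq> v x)"
proof -
  have "Measurable.pred N (\<lambda>x. u x = v x)"
    unfolding pred_def by (rule measurable_equality_set[OF assms])
  then show ?thesis by (rule pred_intros_logic)
qed

locale percolated_points = bounded_density f C
  for f :: "real ^ 'd::{finite,linorder} \<Rightarrow> real" and C :: real +
  fixes M :: "'w measure" and X :: "nat \<Rightarrow> 'w \<Rightarrow> real ^ 'd::{finite,linorder}"
    and p :: "nat \<Rightarrow> real" and keep :: "nat \<Rightarrow> nat set \<Rightarrow> 'w \<Rightarrow> bool"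
  assumes model: "percolation_model M f X p keep"
begin

sublocale prob_space M
  using model by (simp add: percolation_model_def)

abbreviation law :: "(real ^ 'd::{finite,linorder}) measure" where
  "law \<equiv> density lborel (\<lambda>x. ennreal (f x))"

lemma X_distr: "i \<ge> 1 \<Longrightarrow> distr M borel (X i) = law"
  and X_measurable: "i \<ge> 1 \<Longrightarrow> X i \<in> borel_measurable M"
proof -
  assume "i \<ge> 1"
  then have "distributed M lborel (X i) (\<lambda>x. ennreal (f x))"
    using model by (simp add: percolation_model_def)
  then show "distr M borel (X i) = law" "X i \<in> borel_measurable M"
    by (auto simp: distributed_def cong: distr_cong)
qed

lemma keep_measurable: "n \<ge> 1 \<Longrightarrow> e \<in> index_pairs n \<Longrightarrow> Measurable.pred M (keep n e)"
  and keep_prob: "n \<ge> 1 \<Longrightarrow> e \<in> index_pairs n \<Longrightarrow> prob {\<omega> \<in> space M. keep n e \<omega>} = p n"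
  using model by (simp_all add: percolation_model_def)

lemma joint_distr:
  assumes "finite I" "I \<noteq> {}" "I \<subseteq> {1..}"
  shows "distr M (\<Pi>\<^sub>M i\<in>I. borel) (\<lambda>\<omega>. \<lambda>i\<in>I. X i \<omega>) = (\<Pi>\<^sub>M i\<in>I. law)"
proof -
  have "indep_vars (\<lambda>_. borel) X I"
    using model assms(3) indep_vars_subset by (auto simp: percolation_model_def)
  then have "distr M (\<Pi>\<^sub>M i\<in>I. borel) (\<lambda>\<omega>. \<lambda>i\<in>I. X i \<omega>) = (\<Pi>\<^sub>M i\<in>I. distr M borel (X i))"
    using assms X_measurable by (subst (asm) indep_vars_iff_distr_eq_PiM') auto
  also have "\<dots> = (\<Pi>\<^sub>M i\<in>I. law)"
    using assms X_distr by (intro PiM_cong) auto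
  finally show ?thesis .
qed

text \<open>
  The joint law of the points with index in \<open>I\<close> is a power of a single law, hence it does not depend
  on \<open>I\<close> up to a renaming of coordinates.
\<close>

lemma prob_close_rooted:
  assumes I: "finite I" "card I = k" "k \<ge> 1" "I \<subseteq> {1..}" and A[measurable]: "A \<in> sets borel"
  shows "prob {\<omega> \<in> space M. close_rooted A \<rho> I (\<lambda>i. X i \<omega>)} = rooted_prob f A k \<rho>"
proof -
  obtain \<sigma> where \<sigma>: "bij_betw \<sigma> {..<k} I"
    using I ex_bij_betw_nat_finite[of I] by (auto simp: atLeast0LessThan)
  have "I \<noteq> {}" using I by auto
  have sets_law: "sets (\<Pi>\<^sub>M i\<in>J. law) = sets (\<Pi>\<^sub>M i\<in>J. borel)" for J :: "nat set"
    by (intro sets_PiM_cong) auto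
  have \<sigma>_I: "\<sigma> i \<in> I" if "i \<in> {..<k}" for i
    using \<sigma> that by (auto simp: bij_betw_def)
  have reindex: "distr (\<Pi>\<^sub>M i\<in>I. law) (\<Pi>\<^sub>M i\<in>{..<k}. law) (\<lambda>x. \<lambda>i\<in>{..<k}. x (\<sigma> i)) = (\<Pi>\<^sub>M i\<in>{..<k}. law)"
    using \<sigma> \<sigma>_I by (intro distr_PiM_reindex prob_space_f) (auto simp: bij_betw_def)
  have pred: "{x \<in> space (\<Pi>\<^sub>M i\<in>J. law). close_rooted A \<rho> J x} \<in> sets (\<Pi>\<^sub>M i\<in>J. law)" if "finite J" for J :: "nat set"
  proof -
    have "Measurable.pred (\<Pi>\<^sub>M i\<in>J. law) (\<lambda>x. close_rooted A \<rho> J (\<lambda>i. x i))"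
    proof (rule measurable_close_rooted[OF that _ A])
      fix i assume "i \<in> J"
      from measurable_component_singleton[OF this, of "\<lambda>_. law"]
      show "(\<lambda>x. x i) \<in> borel_measurable (\<Pi>\<^sub>M i\<in>J. law)" by simp
    qed
    then show ?thesis by measurable
  qed
  have "rooted_prob f A k \<rho> =
      measure (distr (\<Pi>\<^sub>M i\<in>I. law) (\<Pi>\<^sub>M i\<in>{..<k}. law) (\<lambda>x. \<lambda>i\<in>{..<k}. x (\<sigma> i)))
        {x \<in> space (\<Pi>\<^sub>M i\<in>{..<k}. law). close_rooted A \<rho> {..<k} x}"
    unfolding reindex rooted_prob_def ..
  also have "\<dots> = measure (\<Pi>\<^sub>M i\<in>I. law) ((\<lambda>x. \<lambda>i\<in>{..<k}. x (\<sigma> i)) -`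
      {x \<in> space (\<Pi>\<^sub>M i\<in>{..<k}. law). close_rooted A \<rho> {..<k} x} \<inter> space (\<Pi>\<^sub>M i\<in>I. law))"
    using \<sigma>_I by (intro measure_distr pred measurable_restrict measurable_component_singleton) auto
  also have "(\<lambda>x. \<lambda>i\<in>{..<k}. x (\<sigma> i)) -`
      {x \<in> space (\<Pi>\<^sub>M i\<in>{..<k}. law). close_rooted A \<rho> {..<k} x} \<inter> space (\<Pi>\<^sub>M i\<in>I. law) =
      {x \<in> space (\<Pi>\<^sub>M i\<in>I. law). close_rooted A \<rho> I x}"
  proof -
    have "close_rooted A \<rho> {..<k} (\<lambda>i\<in>{..<k}. x (\<sigma> i)) \<longleftrightarrow> close_rooted A \<rho> I x" for x
      unfolding close_rooted_reindex[OF \<sigma>] by (rule close_rooted_cong) simp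
    then show ?thesis by (auto simp: space_PiM)
  qed
  also have "measure (\<Pi>\<^sub>M i\<in>I. law) {x \<in> space (\<Pi>\<^sub>M i\<in>I. law). close_rooted A \<rho> I x} =
      measure (distr M (\<Pi>\<^sub>M i\<in>I. borel) (\<lambda>\<omega>. \<lambda>i\<in>I. X i \<omega>)) {x \<in> space (\<Pi>\<^sub>M i\<in>I. law). close_rooted A \<rho> I x}"
    unfolding joint_distr[OF I(1) \<open>I \<noteq> {}\<close> I(4)] ..
  also have "\<dots> = prob ((\<lambda>\<omega>. \<lambda>i\<in>I. X i \<omega>) -` {x \<in> space (\<Pi>\<^sub>M i\<in>I. law). close_rooted A \<rho> I x} \<inter> space M)"
    using pred[OF I(1)] I(4) X_measurable unfolding sets_law
    by (intro measure_distr measurable_restrict) auto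
  also have "(\<lambda>\<omega>. \<lambda>i\<in>I. X i \<omega>) -` {x \<in> space (\<Pi>\<^sub>M i\<in>I. law). close_rooted A \<rho> I x} \<inter> space M =
      {\<omega> \<in> space M. close_rooted A \<rho> I (\<lambda>i. X i \<omega>)}"
  proof -
    have "close_rooted A \<rho> I (\<lambda>i\<in>I. X i \<omega>) \<longleftrightarrow> close_rooted A \<rho> I (\<lambda>i. X i \<omega>)" for \<omega>
      by (rule close_rooted_cong) simp
    then show ?thesis by (auto simp: space_PiM)
  qed
  finally show ?thesis ..
qed

text \<open>
  A law with a density has no atoms, so by Fubini's theorem its square does not charge the diagonal.
\<close>

lemma AE_distinct_pair:
  assumes "i \<ge> 1" "j \<ge> 1" "i \<noteq> j"
  shows "AE \<omega> in M. X i \<omega> \<noteq> X j \<omega>"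
proof -
  interpret L: prob_space law
    by (rule prob_space_f)
  interpret L: product_sigma_finite "\<lambda>_ :: nat. law"
    by standard
  interpret LL: pair_sigma_finite law law ..
  have null: "emeasure law {y} = 0" for y
  proof -
    have "emeasure law {y} = (\<integral>\<^sup>+x. ennreal (f x) * indicator {y} x \<partial>lborel)"
      by (simp add: emeasure_density)
    also have "\<dots> = 0"
      by (intro nn_integral_null_set null_setsI) auto
    finally show ?thesis .
  qed
  let ?I = "{i, j}"
  have "AE x in (\<Pi>\<^sub>M i\<in>?I. law). x i \<noteq> x j"
  proof (subst AE_iff_nn_integral)
    have "(\<lambda>x. x l) \<in> borel_measurable (\<Pi>\<^sub>M i\<in>?I. law)" if "l \<in> ?I" for l
      using measurable_component_singleton[OF that, of "\<lambda>_. law"] by simp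
    then have "Measurable.pred (\<Pi>\<^sub>M i\<in>?I. law) (\<lambda>x. x i \<noteq> x j)"
      by (intro measurable_neq) auto
    then show "{x \<in> space (\<Pi>\<^sub>M i\<in>?I. law). x i \<noteq> x j} \<in> sets (\<Pi>\<^sub>M i\<in>?I. law)"
      unfolding pred_def .
    define g :: "real ^ 'd::{finite,linorder} \<Rightarrow> real ^ 'd::{finite,linorder} \<Rightarrow> ennreal"
      where "g u v = indicator {v} u" for u v
    have g: "case_prod g \<in> borel_measurable (law \<Otimes>\<^sub>M law)"
    proof -
      have "case_prod g = (\<lambda>w. if fst w = snd w then 1 else 0)"
        by (auto simp: g_def fun_eq_iff)
      then show ?thesis by simp
    qed
    have "(\<integral>\<^sup>+x. indicator {x. \<not> (x i \<noteq> x j)} x \<partial>(\<Pi>\<^sub>M i\<in>?I. law)) = (\<integral>\<^sup>+x. g (x i) (x j) \<partial>(\<Pi>\<^sub>M i\<in>?I. law))"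
      by (intro nn_integral_cong) (auto simp: g_def indicator_def)
    also have "\<dots> = (\<integral>\<^sup>+w. g (fst w) (snd w) \<partial>(law \<Otimes>\<^sub>M law))"
      by (rule L.product_nn_integral_pair[OF g \<open>i \<noteq> j\<close>])
    also have "\<dots> = (\<integral>\<^sup>+v. \<integral>\<^sup>+u. g u v \<partial>law \<partial>law)"
      using LL.nn_integral_snd[OF g] by (simp add: case_prod_unfold)
    also have "\<dots> = 0"
      by (simp add: g_def null)
    finally show "(\<integral>\<^sup>+x. indicator {x. \<not> (x i \<noteq> x j)} x \<partial>(\<Pi>\<^sub>M i\<in>?I. law)) = 0" .
  qed
  then have "AE x in distr M (\<Pi>\<^sub>M i\<in>?I. borel) (\<lambda>\<omega>. \<lambda>i\<in>?I. X i \<omega>). x i \<noteq> x j"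
    using assms by (subst joint_distr) auto
  moreover have "(\<lambda>\<omega>. \<lambda>i\<in>?I. X i \<omega>) \<in> measurable M (\<Pi>\<^sub>M i\<in>?I. borel)"
    using assms X_measurable by (intro measurable_restrict) auto
  moreover have "{x \<in> space (\<Pi>\<^sub>M i\<in>?I. borel). x i \<noteq> x j} \<in>
      sets (\<Pi>\<^sub>M i\<in>?I. (borel :: (real ^ 'd::{finite,linorder}) measure))"
    using measurable_neq[OF measurable_component_singleton[of i ?I] measurable_component_singleton[of j ?I]]
    unfolding pred_def by simp
  ultimately show ?thesis
    by (subst (asm) AE_distr_iff) simp_all
qed

lemma AE_distinct: "AE \<omega> in M. inj_on (\<lambda>i. X i \<omega>) {1..n}"
proof -
  have "AE \<omega> in M. \<forall>i\<in>{1..n}. \<forall>j\<in>{1..n}. i \<noteq> j \<longrightarrow> X i \<omega> \<noteq> X j \<omega>"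
    by (intro AE_finite_allI) (auto intro: AE_distinct_pair)
  then show ?thesis
    by eventually_elim (metis inj_onI)
qed

text \<open>
  Joint independence is grouped into blocks: all points form one block, labelled \<open>None\<close>, and each coin
  is a block of its own. The event about the points belongs to the \<open>\<sigma>\<close>-algebra generated by the block
  of the points, because each point is measurable with respect to it.
\<close>

lemma prob_kept_independent:
  assumes n: "n \<ge> 1" and I: "finite I" "I \<subseteq> {1..}" and E: "finite E" "E \<subseteq> index_pairs n"
    and A: "A \<in> sets borel"
  shows "prob {\<omega> \<in> space M. close_rooted A \<rho> I (\<lambda>i. X i \<omega>) \<and> (\<forall>e\<in>E. keep n e \<omega>)} =
    prob {\<omega> \<in> space M. close_rooted A \<rho> I (\<lambda>i. X i \<omega>)} * p n ^ card E"
proof -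
  define F where "F = case_sum (\<lambda>i. events_of M borel (X i)) (\<lambda>e. events_of M (count_space UNIV) (keep n e))"
  define block where "block = case_option (Inl ` {1..}) (\<lambda>e. {Inr e :: nat + nat set})"
  define J where "J = insert None (Some ` E)"
  have sub: "(\<Union>j\<in>J. block j) \<subseteq> Inl ` {1..} \<union> Inr ` index_pairs n"
    using E by (auto simp: J_def block_def)
  have "indep_sets F (Inl ` {1..} \<union> Inr ` index_pairs n)"
    using model n by (simp add: percolation_model_def F_def)
  then have indep: "indep_sets F (\<Union>j\<in>J. block j)"
    using sub by (rule indep_sets_mono_index[rotated])
  have "indep_sets (\<lambda>j. sigma_sets (space M) (\<Union>i\<in>block j. F i)) J"
  proof (rule indep_sets_collect_sigma[OF indep])
    show "Int_stable (F i)" for i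
      by (cases i) (simp_all add: F_def Int_stable_events_of)
    show "disjoint_family_on block J"
      by (auto simp: disjoint_family_on_def J_def block_def)
  qed
  moreover define D where "D = case_option {\<omega> \<in> space M. close_rooted A \<rho> I (\<lambda>i. X i \<omega>)} (\<lambda>e. {\<omega> \<in> space M. keep n e \<omega>})"
  have "D j \<in> sigma_sets (space M) (\<Union>i\<in>block j. F i)" if "j \<in> J" for j
  proof (cases j)
    case None
    \<comment> \<open>Measurability with respect to this smaller \<open>\<sigma>\<close>-algebra follows by the same lemma as with respect to \<open>M\<close>.\<close>
    define N where "N = sigma (space M) (\<Union>i\<in>{1..}. events_of M borel (X i))"
    have gen: "(\<Union>i\<in>{1..}. events_of M borel (X i)) \<subseteq> Pow (space M)"
      by (auto simp: events_of_def)
    have space_N: "space N = space M"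
      unfolding N_def using gen by (rule space_measure_of)
    have "X i \<in> borel_measurable N" if "i \<in> I" for i
    proof (rule measurableI)
      fix S :: "(real ^ 'd::{finite,linorder}) set" assume "S \<in> sets borel"
      then have "X i -` S \<inter> space M \<in> (\<Union>i\<in>{1..}. events_of M borel (X i))"
        using that I by (auto simp: events_of_def)
      then show "X i -` S \<inter> space N \<in> sets N"
        unfolding space_N unfolding N_def using gen by simp
    qed simp
    then have "Measurable.pred N (\<lambda>\<omega>. close_rooted A \<rho> I (\<lambda>i. X i \<omega>))"
      using I A by (intro measurable_close_rooted)
    then have "{\<omega> \<in> space N. close_rooted A \<rho> I (\<lambda>i. X i \<omega>)} \<in> sets N"
      by measurable
    then have "{\<omega> \<in> space M. close_rooted A \<rho> I (\<lambda>i. X i \<omega>)} \<in>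
        sigma_sets (space M) (\<Union>i\<in>{1..}. events_of M borel (X i))"
      unfolding space_N unfolding N_def sets_measure_of[OF gen] .
    then show ?thesis
      by (simp add: None D_def block_def F_def)
  next
    case (Some e)
    have "{\<omega> \<in> space M. keep n e \<omega>} \<in> events_of M (count_space UNIV) (keep n e)"
      unfolding events_of_def by (intro CollectI exI[of _ "{True}"]) auto
    then show ?thesis
      by (simp add: Some D_def block_def F_def sigma_sets.Basic)
  qed
  moreover have "finite J" "J \<noteq> {}"
    using E by (auto simp: J_def)
  ultimately have "prob (\<Inter>j\<in>J. D j) = (\<Prod>j\<in>J. prob (D j))"
    by (intro indep_setsD[where I=J]) auto
  also have "(\<Inter>j\<in>J. D j) = {\<omega> \<in> space M. close_rooted A \<rho> I (\<lambda>i. X i \<omega>) \<and> (\<forall>e\<in>E. keep n e \<omega>)}"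
    by (auto simp: J_def D_def)
  also have "(\<Prod>j\<in>J. prob (D j)) = prob (D None) * (\<Prod>e\<in>E. prob (D (Some e)))"
    using E by (simp add: J_def prod.reindex)
  also have "(\<Prod>e\<in>E. prob (D (Some e))) = (\<Prod>e\<in>E. p n)"
    using E n by (intro prod.cong) (auto simp: D_def keep_prob)
  finally show ?thesis by (simp add: D_def)
qed

end

section \<open>Expected numbers of cliques\<close>

lemma finite_index_pairs: "finite (index_pairs n)"
  by (rule finite_subset[of _ "Pow {1..n}"]) (auto simp: index_pairs_def)

lemma image_eq_pair:
  "g ` e = {a, b} \<longleftrightarrow> (\<forall>l\<in>e. g l = a \<or> g l = b) \<and> (\<exists>l\<in>e. g l = a) \<and> (\<exists>l\<in>e. g l = b)"
proof -
  have "g ` e = {a, b} \<longleftrightarrow> g ` e \<subseteq> {a, b} \<and> a \<in> g ` e \<and> b \<in> g ` e"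
    by blast
  then show ?thesis
    by (simp add: image_subset_iff image_iff eq_commute)
qed

lemma binomial_asymptotics: "(\<lambda>n. real (n choose k) / real n ^ k) \<longlonglongrightarrow> 1 / fact k"
proof -
  have "(\<lambda>n. (real n - real i) / real n) \<longlonglongrightarrow> 1" for i
  proof -
    have "(\<lambda>n. 1 - real i / real n) \<longlonglongrightarrow> 1 - 0"
      by (intro tendsto_intros lim_const_over_n)
    moreover have "\<forall>\<^sub>F n in sequentially. 1 - real i / real n = (real n - real i) / real n"
      by (intro eventually_sequentiallyI[of 1]) (simp add: diff_divide_distrib)
    ultimately show ?thesis
      by (simp add: Lim_transform_eventually)
  qed
  then have "(\<lambda>n. (\<Prod>i=0..<k. (real n - real i) / real n) / fact k) \<longlonglongrightarrow> (\<Prod>i=0..<k. 1) / fact k"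
    by (intro tendsto_intros) auto
  moreover have "(\<Prod>i=0..<k. (real n - real i) / real n) / fact k = real (n choose k) / real n ^ k" for n
    by (simp add: binomial_gbinomial gbinomial_prod_rev prod_dividef)
  ultimately show ?thesis by simp
qed

context prob_space
begin

lemma
  assumes [measurable]: "Measurable.pred M P"
  shows integrable_of_bool: "integrable M (\<lambda>\<omega>. of_bool (P \<omega>) :: real)"
    and integral_of_bool: "(\<integral>\<omega>. of_bool (P \<omega>) \<partial>M) = prob {\<omega> \<in> space M. P \<omega>}"
proof -
  have eq: "(of_bool (P \<omega>) :: real) = indicator {\<omega> \<in> space M. P \<omega>} \<omega>" if "\<omega> \<in> space M" for \<omega>
    using that by simp
  show "integrable M (\<lambda>\<omega>. of_bool (P \<omega>) :: real)"
    by (rule integrable_const_bound[where B = 1]) auto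
  have "(\<integral>\<omega>. of_bool (P \<omega>) \<partial>M) = (\<integral>\<omega>. indicator {\<omega> \<in> space M. P \<omega>} \<omega> \<partial>M :: real)"
    by (rule Bochner_Integration.integral_cong[OF refl eq])
  then show "(\<integral>\<omega>. of_bool (P \<omega>) \<partial>M) = prob {\<omega> \<in> space M. P \<omega>}"
    by simp
qed

text \<open>
  The two sums agree only almost everywhere, and measurability does not pass from one to the other on an
  incomplete space; hence it is assumed for both families.
\<close>

lemma expectation_count:
  assumes F: "finite F" and P: "\<And>I. I \<in> F \<Longrightarrow> Measurable.pred M (P I)"
    and Q: "\<And>I. I \<in> F \<Longrightarrow> Measurable.pred M (Q I)"
    and eq: "AE \<omega> in M. \<forall>I\<in>F. P I \<omega> \<longleftrightarrow> Q I \<omega>"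
  shows "(\<integral>\<omega>. (\<Sum>I\<in>F. of_bool (P I \<omega>)) \<partial>M) = (\<Sum>I\<in>F. prob {\<omega> \<in> space M. Q I \<omega>})"
proof -
  have "(\<integral>\<omega>. (\<Sum>I\<in>F. of_bool (P I \<omega>) :: real) \<partial>M) = (\<integral>\<omega>. (\<Sum>I\<in>F. of_bool (Q I \<omega>)) \<partial>M)"
  proof (rule integral_cong_AE)
    show "AE \<omega> in M. (\<Sum>I\<in>F. of_bool (P I \<omega>) :: real) = (\<Sum>I\<in>F. of_bool (Q I \<omega>))"
      using eq by eventually_elim (simp cong: sum.cong)
  qed (use P Q integrable_of_bool in \<open>auto intro!: borel_measurable_sum\<close>)
  also have "\<dots> = (\<Sum>I\<in>F. prob {\<omega> \<in> space M. Q I \<omega>})"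
    using Q by (simp add: Bochner_Integration.integral_sum integrable_of_bool integral_of_bool)
  finally show ?thesis .
qed

end

context percolated_points
begin

lemma measurable_in_first_indices:
  assumes "I \<subseteq> {1..n}"
  shows "Measurable.pred M (\<lambda>\<omega>. I \<subseteq> first_indices n (\<lambda>i. X i \<omega>))"
proof -
  have "I \<subseteq> first_indices n (\<lambda>i. X i \<omega>) \<longleftrightarrow> (\<forall>i\<in>I. \<forall>j\<in>{1..<i}. X j \<omega> \<noteq> X i \<omega>)" for \<omega>
    using assms by (auto simp: first_indices_def)
  moreover have "Measurable.pred M (\<lambda>\<omega>. \<forall>i\<in>I. \<forall>j\<in>{1..<i}. X j \<omega> \<noteq> X i \<omega>)"
    using assms finite_subset[OF assms]
    by (intro pred_intros_finite measurable_neq X_measurable) auto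
  ultimately show ?thesis by simp
qed

text \<open>
  The images of finite index sets under the random points are compared element by element, which leaves
  finitely many equalities between points.
\<close>

lemma measurable_coins_kept:
  assumes n: "n \<ge> 1" and I: "I \<subseteq> {1..n}"
  shows "Measurable.pred M (\<lambda>\<omega>. coins_kept n (\<lambda>e. keep n e \<omega>) I (\<lambda>i. X i \<omega>))"
proof -
  have eq: "Measurable.pred M (\<lambda>\<omega>. X i \<omega> = X j \<omega>)" if "i \<ge> 1" "j \<ge> 1" for i j
    unfolding pred_def by (rule measurable_equality_set) (auto intro: X_measurable that)
  have image_eq: "(\<lambda>i. X i \<omega>) ` e = {X i \<omega>, X j \<omega>} \<longleftrightarrow> (\<forall>l\<in>e. X l \<omega> = X i \<omega> \<or> X l \<omega> = X j \<omega>) \<and>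
      (\<exists>l\<in>e. X l \<omega> = X i \<omega>) \<and> (\<exists>l\<in>e. X l \<omega> = X j \<omega>)" for \<omega> e i j
    by (rule image_eq_pair)
  have image: "Measurable.pred M (\<lambda>\<omega>. (\<lambda>i. X i \<omega>) ` e = {X i \<omega>, X j \<omega>})"
    if "e \<in> index_pairs n" "i \<ge> 1" "j \<ge> 1" for e i j
  proof -
    have "finite e" "\<And>l. l \<in> e \<Longrightarrow> l \<ge> 1"
      using that finite_subset[of e "{1..n}"] by (auto simp: index_pairs_def)
    then show ?thesis
      unfolding image_eq using that by (intro pred_intros_logic pred_intros_finite eq) auto
  qed
  show ?thesis
    unfolding coins_kept_def using I finite_subset[OF I] n
    by (intro pred_intros_logic pred_intros_finite image keep_measurable finite_index_pairs) auto
qed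

lemma measurable_close_rooted_points:
  assumes "I \<subseteq> {1..n}" "A \<in> sets borel"
  shows "Measurable.pred M (\<lambda>\<omega>. close_rooted A \<rho> I (\<lambda>i. X i \<omega>))"
  using assms finite_subset[OF assms(1)] by (intro measurable_close_rooted X_measurable) auto

lemma expectation_rgg_count:
  assumes "complete_digraph k \<Gamma>" "k \<ge> 1" "A \<in> sets borel"
  shows "(\<integral>\<omega>. real (rgg_count \<Gamma> A X r n \<omega>) \<partial>M) = real (n choose k) * rooted_prob f A k (r n)"
proof -
  let ?F = "{I. I \<subseteq> {1..n} \<and> card I = k}"
  have "(\<integral>\<omega>. real (rgg_count \<Gamma> A X r n \<omega>) \<partial>M) =
      (\<Sum>I\<in>?F. prob {\<omega> \<in> space M. close_rooted A (r n) I (\<lambda>i. X i \<omega>)})"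
    unfolding rgg_count_by_indices[OF assms(1,2)]
  proof (rule expectation_count)
    show "AE \<omega> in M. \<forall>I\<in>?F. (I \<subseteq> first_indices n (\<lambda>i. X i \<omega>) \<and> close_rooted A (r n) I (\<lambda>i. X i \<omega>)) \<longleftrightarrow>
        close_rooted A (r n) I (\<lambda>i. X i \<omega>)"
      using AE_distinct[of n] by eventually_elim (simp add: first_indices_inj)
  qed (auto intro!: pred_intros_logic measurable_in_first_indices measurable_close_rooted_points[where n=n] assms)
  also have "\<dots> = (\<Sum>I\<in>?F. rooted_prob f A k (r n))"
    using assms finite_subset[of _ "{1..n}"] by (intro sum.cong prob_close_rooted refl) auto
  also have "\<dots> = real (n choose k) * rooted_prob f A k (r n)"
    using n_subsets[of "{1..n}" k] by simp
  finally show ?thesis .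
qed

lemma expectation_percolated_rgg_count:
  assumes "complete_digraph k \<Gamma>" "k \<ge> 1" "A \<in> sets borel" and n: "n \<ge> 1"
  shows "(\<integral>\<omega>. real (percolated_rgg_count \<Gamma> A X keep r n \<omega>) \<partial>M) =
    p n ^ (k choose 2) * (\<integral>\<omega>. real (rgg_count \<Gamma> A X r n \<omega>) \<partial>M)"
proof -
  let ?F = "{I. I \<subseteq> {1..n} \<and> card I = k}"
  let ?E = "\<lambda>I. {e. e \<subseteq> I \<and> card e = 2}"
  have E: "finite (?E I)" "?E I \<subseteq> index_pairs n" "card (?E I) = k choose 2" "finite I" if "I \<in> ?F" for I
    using that finite_subset[of I "{1..n}"] n_subsets[of I 2] by (auto simp: index_pairs_def)
  have "(\<integral>\<omega>. real (percolated_rgg_count \<Gamma> A X keep r n \<omega>) \<partial>M) =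
      (\<Sum>I\<in>?F. prob {\<omega> \<in> space M. close_rooted A (r n) I (\<lambda>i. X i \<omega>) \<and> (\<forall>e\<in>?E I. keep n e \<omega>)})"
    unfolding percolated_rgg_count_by_indices[OF assms(1,2)]
  proof (rule expectation_count)
    show "AE \<omega> in M. \<forall>I\<in>?F. (I \<subseteq> first_indices n (\<lambda>i. X i \<omega>) \<and> close_rooted A (r n) I (\<lambda>i. X i \<omega>) \<and>
        coins_kept n (\<lambda>e. keep n e \<omega>) I (\<lambda>i. X i \<omega>)) \<longleftrightarrow>
        close_rooted A (r n) I (\<lambda>i. X i \<omega>) \<and> (\<forall>e\<in>?E I. keep n e \<omega>)"
      using AE_distinct[of n]
      by eventually_elim (simp add: first_indices_inj coins_kept_inj)
    fix I assume I: "I \<in> ?F"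
    show "Measurable.pred M (\<lambda>\<omega>. close_rooted A (r n) I (\<lambda>i. X i \<omega>) \<and> (\<forall>e\<in>?E I. keep n e \<omega>))"
    proof (rule pred_intros_logic)
      show "Measurable.pred M (\<lambda>\<omega>. close_rooted A (r n) I (\<lambda>i. X i \<omega>))"
        using I assms by (intro measurable_close_rooted_points[where n=n]) auto
      show "Measurable.pred M (\<lambda>\<omega>. \<forall>e\<in>?E I. keep n e \<omega>)"
        using n E(2)[OF I] by (intro pred_intros_finite E(1)[OF I] keep_measurable) auto
    qed
  qed (auto intro!: pred_intros_logic measurable_in_first_indices measurable_coins_kept
      measurable_close_rooted_points[where n=n] assms)
  also have "\<dots> = (\<Sum>I\<in>?F. p n ^ (k choose 2) * rooted_prob f A k (r n))"
  proof (rule sum.cong[OF refl])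
    fix I assume I: "I \<in> ?F"
    have "prob {\<omega> \<in> space M. close_rooted A (r n) I (\<lambda>i. X i \<omega>) \<and> (\<forall>e\<in>?E I. keep n e \<omega>)} =
        prob {\<omega> \<in> space M. close_rooted A (r n) I (\<lambda>i. X i \<omega>)} * p n ^ card (?E I)"
      using I by (intro prob_kept_independent n E assms) auto
    also have "prob {\<omega> \<in> space M. close_rooted A (r n) I (\<lambda>i. X i \<omega>)} = rooted_prob f A k (r n)"
      using I E(4)[OF I] assms by (intro prob_close_rooted) auto
    finally show "prob {\<omega> \<in> space M. close_rooted A (r n) I (\<lambda>i. X i \<omega>) \<and> (\<forall>e\<in>?E I. keep n e \<omega>)} =
        p n ^ (k choose 2) * rooted_prob f A k (r n)"
      by (simp only: E(3)[OF I] mult.commute)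
  qed
  also have "\<dots> = p n ^ (k choose 2) * (\<integral>\<omega>. real (rgg_count \<Gamma> A X r n \<omega>) \<partial>M)"
    using n_subsets[of "{1..n}" k] by (simp add: expectation_rgg_count[OF assms(1-3)])
  finally show ?thesis .
qed

end

lemma mu_limit_complete:
  fixes f :: "real ^ 'd::finite \<Rightarrow> real"
  assumes "complete_digraph k \<Gamma>" "k \<ge> 1"
  shows "mu_limit f \<Gamma> A = 1 / fact k * (\<integral>x. f x ^ k * indicator A x \<partial>lborel) *
    (\<integral>z. of_bool (pairwise_close 1 {..<k} (z(0 := 0 :: real ^ 'd::finite))) \<partial>(\<Pi>\<^sub>M i\<in>{1..<k}. lborel))"
proof -
  have "card (verts \<Gamma>) = k"
    using assms by (simp add: complete_digraph_def)
  show ?thesis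
    unfolding mu_limit_def Let_def \<open>card (verts \<Gamma>) = k\<close> h_fun_complete[OF assms] set_lebesgue_integral_def
    by (simp add: mult.commute)
qed

theorem corollary2p5:
  fixes M :: "'w measure"
    and f :: "real ^ 'd::{finite,linorder} \<Rightarrow> real"
    and X :: "nat \<Rightarrow> 'w \<Rightarrow> real ^ 'd::{finite,linorder}"
    and keep :: "nat \<Rightarrow> nat set \<Rightarrow> 'w \<Rightarrow> bool"
    and p r :: "nat \<Rightarrow> real"
    and \<Gamma> :: "('v, 'e) pre_digraph"
    and k :: nat
    and A :: "(real ^ 'd::{finite,linorder}) set"
  assumes "f \<in> borel_measurable borel"
    and "\<And>x. 0 \<le> f x"
    and "bounded (range f)"
    and "(\<integral>\<^sup>+ x. ennreal (f x) \<partial>lborel) = 1"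
    and "\<And>n. n \<ge> 1 \<Longrightarrow> 0 < r n"
    and "\<And>n. n \<ge> 1 \<Longrightarrow> 0 < p n \<and> p n \<le> 1"
    and "percolation_model M f X p keep"
    and "k \<ge> 2"
    and "complete_digraph k \<Gamma>"
    and "open A"
    and "emeasure lborel (frontier A) = 0"
    and "r \<longlonglongrightarrow> 0"
  shows "(\<forall>n\<ge>1. (LINT \<omega>|M. real (percolated_rgg_count \<Gamma> A X keep r n \<omega>)) =
             p n ^ (k choose 2) * (LINT \<omega>|M. real (rgg_count \<Gamma> A X r n \<omega>))) \<and>
         (\<lambda>n. (LINT \<omega>|M. real (percolated_rgg_count \<Gamma> A X keep r n \<omega>)) /
               (p n ^ (k choose 2) * real n ^ k * r n ^ (CARD('d) * (k - 1))))
            \<longlonglongrightarrow> mu_limit f \<Gamma> A"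
proof -
  obtain C where "\<And>x. f x \<le> C"
    using assms(3) by (auto simp: bounded_iff dest: abs_le_D1)
  then interpret percolated_points f C M X p keep
    using assms by unfold_locales auto
  have k: "k \<ge> 1" using \<open>k \<ge> 2\<close> by simp
  have A: "A \<in> sets borel" using \<open>open A\<close> by simp
  note percolated = expectation_percolated_rgg_count[OF \<open>complete_digraph k \<Gamma>\<close> k A]
  note unpercolated = expectation_rgg_count[OF \<open>complete_digraph k \<Gamma>\<close> k A]
  have "(\<lambda>n. real (n choose k) / real n ^ k * (rooted_prob f A k (r n) / r n ^ (CARD('d) * (k - 1))))
      \<longlonglongrightarrow> mu_limit f \<Gamma> A"
    unfolding mu_limit_complete[OF \<open>complete_digraph k \<Gamma>\<close> k] mult.assoc
    using assms(5,10-12) k by (intro tendsto_mult binomial_asymptotics rooted_prob_limit)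
  moreover have "\<forall>\<^sub>F n in sequentially.
      real (n choose k) / real n ^ k * (rooted_prob f A k (r n) / r n ^ (CARD('d) * (k - 1))) =
      (LINT \<omega>|M. real (percolated_rgg_count \<Gamma> A X keep r n \<omega>)) /
        (p n ^ (k choose 2) * real n ^ k * r n ^ (CARD('d) * (k - 1)))"
  proof (rule eventually_sequentiallyI[of 1])
    fix n :: nat assume n: "1 \<le> n"
    then have "p n \<noteq> 0" using assms(6)[of n] by simp
    then show "real (n choose k) / real n ^ k * (rooted_prob f A k (r n) / r n ^ (CARD('d) * (k - 1))) =
      (LINT \<omega>|M. real (percolated_rgg_count \<Gamma> A X keep r n \<omega>)) /
        (p n ^ (k choose 2) * real n ^ k * r n ^ (CARD('d) * (k - 1)))"
      unfolding percolated[OF n] unpercolated by simp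
  qed
  ultimately have "(\<lambda>n. (LINT \<omega>|M. real (percolated_rgg_count \<Gamma> A X keep r n \<omega>)) /
               (p n ^ (k choose 2) * real n ^ k * r n ^ (CARD('d) * (k - 1))))
            \<longlonglongrightarrow> mu_limit f \<Gamma> A"
    by (rule Lim_transform_eventually)
  with percolated show ?thesis by blast
qed

end
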